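(* Let $k,l$ be positive integers with $k$ odd. Let $\sigma,\tau$ be nonzero complex numbers such that the numbers $\tau_1=(2\pi i)^{l-k}\tau$ and $\sigma_1=(-1)^{l-k}(2\pi i)^{l-k}\overline{\sigma}$ are different and have nonzero imaginary parts of the same sign. Suppose that $f,g,f_1,g_1\in\mathcal{D}(\mathbb{R}^2)$ satisfy $$(\partial_1^k-\tau\partial_2^l)f_1=f,\qquad(\partial_1^k-\sigma\partial_2^l)g_1=g.$$ Then $$\left|\langle f_1,g_1\rangle_{W_2^{\frac{k-1}{2},\frac{l-1}{2}}(\mathbb{R}^2)}\right|\leqslant C_{\tau,\sigma}\|f\|_{L^1(\mathbb{R}^2)}\|g\|_{L^1(\mathbb{R}^2)},$$ where $C_{\tau,\sigma}$ depends only on $\tau,\sigma$ (and $k,l$).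
   Context: $\mathcal{D}(\mathbb{R}^2)$ is the space of infinitely differentiable compactly supported functions on the plane. The Fourier transform is $\hat f(\xi,\eta)=\int_{\mathbb{R}^2}f(x,y)e^{-2\pi i(x\xi+y\eta)}\,dx\,dy$. The scalar product is $\langle f_1,g_1\rangle_{W_2^{\frac{k-1}{2},\frac{l-1}{2}}(\mathbb{R}^2)}=\int_{\mathbb{R}^2}\hat f_1(\xi,\eta)\overline{\hat g_1(\xi,\eta)}\,|\xi|^{k-1}|\eta|^{l-1}\,d\xi\,d\eta$. *)

theory Defs
  imports "HOL-Analysis.Analysis"
begin

definition partial1 :: "(real \<times> real \<Rightarrow> complex) \<Rightarrow> (real \<times> real \<Rightarrow> complex)" where
  "partial1 f = (\<lambda>(x, y). vector_derivative (\<lambda>t. f (t, y)) (at x))"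

definition partial2 :: "(real \<times> real \<Rightarrow> complex) \<Rightarrow> (real \<times> real \<Rightarrow> complex)" where
  "partial2 f = (\<lambda>(x, y). vector_derivative (\<lambda>t. f (x, t)) (at y))"

inductive_set pderivs :: "(real \<times> real \<Rightarrow> complex) \<Rightarrow> (real \<times> real \<Rightarrow> complex) set"
  for f where
    base: "f \<in> pderivs f"
  | d1: "h \<in> pderivs f \<Longrightarrow> partial1 h \<in> pderivs f"
  | d2: "h \<in> pderivs f \<Longrightarrow> partial2 h \<in> pderivs f"

text \<open>Infinitely differentiable: every iterated partial derivative is (Frechet) differentiable
  everywhere (hence all of them are continuous).\<close>
definition smooth2 :: "(real \<times> real \<Rightarrow> complex) \<Rightarrow> bool" where
  "smooth2 f \<longleftrightarrow> (\<forall>h\<in>pderivs f. \<forall>z. h differentiable (at z))"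

definition test_fun :: "(real \<times> real \<Rightarrow> complex) \<Rightarrow> bool" where
  "test_fun f \<longleftrightarrow> smooth2 f \<and> compact (closure {z. f z \<noteq> 0})"

definition fourier2 :: "(real \<times> real \<Rightarrow> complex) \<Rightarrow> (real \<times> real \<Rightarrow> complex)" where
  "fourier2 f = (\<lambda>(\<xi>, \<eta>). integral\<^sup>L lborel
      (\<lambda>(x, y). f (x, y) * exp (- 2 * pi * \<i> * complex_of_real (x * \<xi> + y * \<eta>))))"

definition L1norm :: "(real \<times> real \<Rightarrow> complex) \<Rightarrow> real" where
  "L1norm f = integral\<^sup>L lborel (\<lambda>z. norm (f z))"

definition W_inner :: "nat \<Rightarrow> nat \<Rightarrow> (real \<times> real \<Rightarrow> complex) \<Rightarrow> (real \<times> real \<Rightarrow> complex) \<Rightarrow> complex" where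
  "W_inner k l f g = integral\<^sup>L lborel
      (\<lambda>(\<xi>, \<eta>). fourier2 f (\<xi>, \<eta>) * cnj (fourier2 g (\<xi>, \<eta>))
                  * complex_of_real (\<bar>\<xi>\<bar> ^ (k - 1) * \<bar>\<eta>\<bar> ^ (l - 1)))"

end

theory Submission
  imports Defs "HOL-Real_Asymp.Real_Asymp"
begin

text \<open>
  Write \<open>\<alpha> = \<tau>\<^sub>1\<close> and \<open>\<beta> = \<sigma>\<^sub>1\<close>. On the Fourier side the two equations divide \<open>f\<close> and \<open>g\<close> by symbols, so
  the scalar product is, up to the factor \<open>(2\<pi>)\<close> to the power \<open>-2k\<close>, the integral of
  \<open>fourier f * cnj (fourier g)\<close> against
  \<open>\<bar>\<eta>\<bar> ^ (l-1) * \<xi> ^ (k-1) / ((\<xi> ^ k - \<alpha> \<eta> ^ l) (\<xi> ^ k - \<beta> \<eta> ^ l))\<close> (here \<open>k\<close> odd is used).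
  For fixed \<open>\<eta>\<close>, undo both Fourier transforms and integrate in \<open>\<xi>\<close> first. After the scaling
  \<open>\<xi> = \<bar>\<eta>\<bar> powr (l/k) * x\<close> the result is \<open>\<Phi>(s \<bar>\<eta>\<bar> powr (l/k)) / \<bar>\<eta>\<bar>\<close>, where \<open>s\<close> is the difference of the first
  coordinates and \<open>\<Phi>\<close> is the Fourier transform of \<open>x ^ (k-1) / ((x ^ k \<mp> \<alpha>) (x ^ k \<mp> \<beta>))\<close>.
  Integration by parts gives \<open>\<Phi>(s) = O(1/\<bar>s\<bar>)\<close>; as \<open>\<alpha>\<close> and \<open>\<beta>\<close> lie in the same half-plane,
  \<open>\<Phi>(0) = 0\<close>, whence \<open>\<Phi>(s) = O(sqrt \<bar>s\<bar>)\<close>. So the integral over \<open>\<eta>\<close> converges absolutely, and since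
  \<open>d\<eta>/\<bar>\<eta>\<bar>\<close> is invariant under scaling, its bound does not depend on \<open>s\<close>.
\<close>

section \<open>One-dimensional integrals\<close>

text \<open>The fundamental theorem of calculus on the whole line with vanishing boundary terms.
  Applied to a product it is integration by parts; applied to a logarithm it gives the cancellation
  in the kernel.\<close>

lemma integral_derivative_eq_0:
  fixes F f :: "real \<Rightarrow> complex"
  assumes F: "\<And>x. (F has_vector_derivative f x) (at x)"
    and f: "\<And>x. isCont f x" "integrable lborel f"
    and lim: "(F \<longlongrightarrow> 0) at_top" "(F \<longlongrightarrow> 0) at_bot"
  shows "integral\<^sup>L lborel f = 0"
proof -
  have "(LBINT x=-\<infinity>..\<infinity>. f x) = 0 - 0"
    using F f lim
    by (intro interval_integral_FTC_integrable[where F = F])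
       (simp_all add: ereal_tendsto_simps set_integrable_def)
  then show ?thesis
    by (simp add: interval_lebesgue_integral_def set_lebesgue_integral_def)
qed

text \<open>The reflection x to -x exchanges the two half-lines, and the origin is a null
  set.\<close>

lemma nn_integral_even:
  fixes h :: "real \<Rightarrow> real"
  assumes [measurable]: "h \<in> borel_measurable borel"
  shows "(\<integral>\<^sup>+x. ennreal (h \<bar>x\<bar>) \<partial>lborel) = 2 * (\<integral>\<^sup>+x. ennreal (h x) * indicator {0<..} x \<partial>lborel)"
proof -
  have "(\<integral>\<^sup>+x. ennreal (h \<bar>x\<bar>) \<partial>lborel)
      = (\<integral>\<^sup>+x. ennreal (h x) * indicator {0<..} x + ennreal (h (-x)) * indicator {..<0} x \<partial>lborel)"
    using AE_lborel_singleton[of "0::real"]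
    by (intro nn_integral_cong_AE) (auto elim!: eventually_mono simp: indicator_def abs_if)
  also have "\<dots> = (\<integral>\<^sup>+x. ennreal (h x) * indicator {0<..} x \<partial>lborel)
      + (\<integral>\<^sup>+x. ennreal (h (-x)) * indicator {..<0} x \<partial>lborel)"
    by (intro nn_integral_add) auto
  also have "(\<integral>\<^sup>+x. ennreal (h (-x)) * indicator {..<0} x \<partial>lborel)
      = (\<integral>\<^sup>+x. ennreal (h x) * indicator {0<..} x \<partial>lborel)"
    by (subst nn_integral_real_affine[where c = "-1" and t = 0])
       (auto intro!: nn_integral_cong simp: indicator_def)
  finally show ?thesis
    by (simp add: mult_2)
qed

text \<open>The exponent \<open>a\<close> governs integrability at 0 and \<open>b\<close> at
  infinity. The function is the majorant both for the scale-invariant integral and for the weighted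
  decay of the kernel.\<close>

lemma nn_integral_two_powers_less_top:
  fixes a b :: real
  assumes a: "a > -1" and b: "b < -1"
  shows "(\<integral>\<^sup>+x. ennreal (if \<bar>x\<bar> \<le> 1 then \<bar>x\<bar> powr a else \<bar>x\<bar> powr b) \<partial>lborel) < \<infinity>"
proof -
  let ?h = "\<lambda>x::real. if x \<le> 1 then x powr a else x powr b"
  have 1: "(\<integral>\<^sup>+x. ennreal (x powr a) * indicator {0..1} x \<partial>lborel) < \<infinity>"
    using nn_integral_has_integral_lebesgue[OF _ has_integral_powr_from_0[OF a, of 1]]
    by (simp add: nn_integral_completion ennreal_indicator[symmetric] mult.commute flip: ennreal_mult'')
  have 2: "(\<integral>\<^sup>+x. ennreal (x powr b) * indicator {1..} x \<partial>lborel) < \<infinity>"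
    using nn_integral_has_integral_lebesgue[OF _ has_integral_powr_to_inf[of b 1]] b
    by (simp add: nn_integral_completion ennreal_indicator[symmetric] mult.commute flip: ennreal_mult'')
  have "(\<integral>\<^sup>+x. ennreal (?h x) * indicator {0<..} x \<partial>lborel)
     \<le> (\<integral>\<^sup>+x. ennreal (x powr a) * indicator {0..1} x + ennreal (x powr b) * indicator {1..} x \<partial>lborel)"
    by (intro nn_integral_mono) (auto simp: indicator_def)
  also have "\<dots> = (\<integral>\<^sup>+x. ennreal (x powr a) * indicator {0..1} x \<partial>lborel)
     + (\<integral>\<^sup>+x. ennreal (x powr b) * indicator {1..} x \<partial>lborel)"
    by (intro nn_integral_add) auto
  also have "\<dots> < \<infinity>" using 1 2 by simp
  finally show ?thesis
    by (subst nn_integral_even[of ?h]) (auto simp: ennreal_mult_less_top)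
qed

lemma integrable_two_powers:
  fixes a b :: real
  assumes "a > -1" "b < -1"
  shows "integrable lborel (\<lambda>x::real. if \<bar>x\<bar> \<le> 1 then \<bar>x\<bar> powr a else \<bar>x\<bar> powr b)"
  using nn_integral_two_powers_less_top[OF assms]
  by (intro integrableI_nonneg) auto

text \<open>The integral is invariant under \<open>x \<mapsto> c x\<close> because \<open>dx/x\<close> is, so it does not depend on \<open>s\<close>.\<close>
lemma nn_integral_min_sqrt_inverse_bounded:
  fixes p :: real
  assumes p: "p > 0"
  obtains B :: real where "B \<ge> 0"
    "\<And>s. s \<ge> 0 \<Longrightarrow> (\<integral>\<^sup>+x. ennreal (min (sqrt (s * \<bar>x\<bar> powr p)) (1 / (s * \<bar>x\<bar> powr p)) / \<bar>x\<bar>) \<partial>lborel) \<le> ennreal B"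
proof -
  let ?h = "\<lambda>s x::real. min (sqrt (s * \<bar>x\<bar> powr p)) (1 / (s * \<bar>x\<bar> powr p)) / \<bar>x\<bar>"
  have "(\<integral>\<^sup>+x. ennreal (?h 1 x) \<partial>lborel)
    \<le> (\<integral>\<^sup>+x. ennreal (if \<bar>x\<bar> \<le> 1 then \<bar>x\<bar> powr (p/2 - 1) else \<bar>x\<bar> powr (-p-1)) \<partial>lborel)"
  proof (intro nn_integral_mono ennreal_leI)
    fix x :: real
    have "sqrt (\<bar>x\<bar> powr p) = \<bar>x\<bar> powr (p/2)"
      by (simp add: powr_half_sqrt[symmetric] powr_powr)
    moreover have "\<bar>x\<bar> powr (p/2 - 1) = \<bar>x\<bar> powr (p/2) / \<bar>x\<bar>"
      "\<bar>x\<bar> powr (-p - 1) = 1 / \<bar>x\<bar> powr p / \<bar>x\<bar>" if "x \<noteq> 0"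
      using that by (auto simp: powr_diff powr_minus_divide)
    ultimately show "?h 1 x \<le> (if \<bar>x\<bar> \<le> 1 then \<bar>x\<bar> powr (p/2 - 1) else \<bar>x\<bar> powr (-p-1))"
      by (cases "x = 0") (auto simp flip: divide_divide_eq_left intro!: divide_right_mono)
  qed
  also have "\<dots> < \<infinity>"
    using p by (intro nn_integral_two_powers_less_top) auto
  finally obtain B where B: "B \<ge> 0" "(\<integral>\<^sup>+x. ennreal (?h 1 x) \<partial>lborel) = ennreal B"
    by (cases "\<integral>\<^sup>+x. ennreal (?h 1 x) \<partial>lborel") auto
  have "(\<integral>\<^sup>+x. ennreal (?h s x) \<partial>lborel) \<le> ennreal B" if "s \<ge> 0" for s
  proof (cases "s = 0")
    case False
    \<comment> \<open>With s * c powr p = 1, the substitution x to c x turns the parameter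
      \<open>s\<close> into 1, and the factor c from dx cancels against 1 / \<bar>c x\<bar>.\<close>
    define c where "c = s powr (-1/p)"
    have c: "c > 0" "s * c powr p = 1"
      using that False p unfolding c_def by (simp, subst powr_powr) (auto simp: powr_minus)
    have eq: "c * ?h s (c * x) = ?h 1 x" for x
    proof -
      have "s * \<bar>c * x\<bar> powr p = \<bar>x\<bar> powr p"
        using c by (simp add: abs_mult powr_mult mult.assoc[symmetric])
      then show ?thesis
        using c by (simp add: abs_mult)
    qed
    have "(\<integral>\<^sup>+x. ennreal (?h s x) \<partial>lborel) = ennreal c * (\<integral>\<^sup>+x. ennreal (?h s (c * x)) \<partial>lborel)"
      using c by (subst nn_integral_real_affine[where c = c and t = 0]) auto
    also have "\<dots> = (\<integral>\<^sup>+x. ennreal c * ennreal (?h s (c * x)) \<partial>lborel)"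
      by (subst nn_integral_cmult) auto
    also have "\<dots> = (\<integral>\<^sup>+x. ennreal (?h 1 x) \<partial>lborel)"
      using c by (intro nn_integral_cong) (simp only: eq flip: ennreal_mult' )
    finally show ?thesis
      using B by simp
  \<comment> \<open>For s = 0 the integrand is identically 0, because sqrt 0 = 0 and 1 / 0 =
    0.\<close>
  qed simp
  with B show thesis
    by (intro that) auto
qed

text \<open>For bounded \<open>a\<close> the imaginary part alone keeps \<open>a\<close> away from
  \<alpha>; for large \<open>a\<close> the triangle inequality gives linear growth.\<close>

lemma linear_factor_lower_bound:
  fixes \<alpha> :: complex
  assumes "Im \<alpha> \<noteq> 0"
  obtains c :: real where "c > 0" "\<And>a::real. c * (1 + \<bar>a\<bar>) \<le> cmod (of_real a - \<alpha>)"
proof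
  \<comment> \<open>The first entry is for \<bar>a\<bar> \<le> 1 + 2 * cmod \<alpha>, where 1 +
    \<bar>a\<bar> \<le> 2 * (1 + cmod \<alpha>); the second is for all other \<open>a\<close>, where
    \<bar>a\<bar> - cmod \<alpha> exceeds a quarter of 1 + \<bar>a\<bar>.\<close>
  let ?c = "min (\<bar>Im \<alpha>\<bar> / (2 * (1 + cmod \<alpha>))) (1/4)"
  show "?c > 0" using assms by (auto simp: add_pos_nonneg)
  fix a :: real
  show "?c * (1 + \<bar>a\<bar>) \<le> cmod (of_real a - \<alpha>)"
  proof (cases "\<bar>a\<bar> \<le> 1 + 2 * cmod \<alpha>")
    case True
    have "?c * (1 + \<bar>a\<bar>) \<le> \<bar>Im \<alpha>\<bar> / (2 * (1 + cmod \<alpha>)) * (2 * (1 + cmod \<alpha>))"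
      using True by (intro mult_mono) auto
    also have "\<dots> = \<bar>Im (of_real a - \<alpha>)\<bar>"
      by (simp add: field_simps add_nonneg_eq_0_iff)
    also have "\<dots> \<le> cmod (of_real a - \<alpha>)"
      by (rule abs_Im_le_cmod)
    finally show ?thesis .
  next
    case False
    have "?c * (1 + \<bar>a\<bar>) \<le> 1/4 * (1 + \<bar>a\<bar>)"
      by (intro mult_right_mono min.cobounded2) auto
    also have "\<dots> \<le> \<bar>a\<bar> - cmod \<alpha>" using False norm_ge_zero[of \<alpha>] by argo
    also have "\<dots> \<le> cmod (of_real a - \<alpha>)"
      using norm_triangle_ineq2[of "of_real a" \<alpha>] by simp
    finally show ?thesis .
  qed
qed

section \<open>The rational kernel\<close>

definition fchar :: "real \<Rightarrow> complex" where
  "fchar t = exp (- 2 * pi * \<i> * complex_of_real t)"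

lemma norm_fchar [simp]: "norm (fchar t) = 1"
  by (simp add: fchar_def)

lemma cnj_fchar: "cnj (fchar t) = fchar (- t)"
  by (simp add: fchar_def exp_cnj)

lemma fchar_add: "fchar (s + t) = fchar s * fchar t"
  by (simp add: fchar_def algebra_simps flip: exp_add)

lemma continuous_fchar: "continuous_on UNIV fchar"
  unfolding fchar_def by (intro continuous_intros)

lemma fchar_measurable [measurable]: "fchar \<in> borel_measurable borel"
  using continuous_fchar by (rule borel_measurable_continuous_onI)

lemma has_vector_derivative_fchar:
  "((\<lambda>x. fchar (s * x + t)) has_vector_derivative - (2 * pi * \<i> * s) * fchar (s * x + t)) (at x)"
  unfolding fchar_def
  by (rule has_vector_derivative_eq_rhs,
      (rule derivative_eq_intros has_vector_derivative_real_field refl | simp add: algebra_simps)+)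

text \<open>An interpolation between the trivial bound 2 and a linear bound. The exponent 1/2 is
  chosen because the kernel below may decay only like 1/x^2 (for k = 1): it can be integrated
  against sqrt \<bar>x\<bar> but not against \<bar>x\<bar>.\<close>

lemma norm_fchar_minus_1_le: "norm (fchar t - 1) \<le> 4 * sqrt \<bar>t\<bar>"
proof -
  have "fchar t = exp (\<i> * complex_of_real (- 2 * pi * t))"
    by (simp add: fchar_def algebra_simps)
  then have eq: "norm (fchar t - 1) = 2 * \<bar>sin (pi * t)\<bar>"
    by (simp only: dist_exp_i_1) simp
  have "\<bar>sin (pi * t)\<bar>\<^sup>2 \<le> \<bar>sin (pi * t)\<bar>"
    unfolding power2_eq_square by (intro mult_left_le) auto
  also have "\<dots> \<le> \<bar>pi * t\<bar>"
    by (rule abs_sin_x_le_abs_x)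
  also have "\<dots> \<le> 4 * \<bar>t\<bar>"
    using pi_less_4 by (simp add: abs_mult mult_right_mono)
  finally have "\<bar>sin (pi * t)\<bar> \<le> sqrt (4 * \<bar>t\<bar>)"
    by (rule real_le_rsqrt)
  then show ?thesis
    by (simp add: eq real_sqrt_mult)
qed

text \<open>At a fixed second frequency \<eta>, this is the weight in \<xi> divided by the two
  symbols, up to factors independent of \<xi>. The parameters then carry the power \<eta> ^
  l.\<close>

definition rat_kernel :: "nat \<Rightarrow> complex \<Rightarrow> complex \<Rightarrow> real \<Rightarrow> complex" where
  "rat_kernel k \<alpha> \<beta> x = of_real x ^ (k - 1) / ((of_real x ^ k - \<alpha>) * (of_real x ^ k - \<beta>))"

text \<open>For \<bar>x\<bar> > 1 the exponents compare as j + 2 \<le> k + 1 \<le> 2 k; for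
  \<bar>x\<bar> \<le> 1 the left side is at most 2.\<close>

lemma power_times_quadratic_le:
  fixes x :: real
  assumes "k > 0" "j \<le> k - 1"
  shows "\<bar>x\<bar> ^ j * (1 + x\<^sup>2) \<le> 2 * (1 + \<bar>x\<bar> ^ k)\<^sup>2"
proof (cases "\<bar>x\<bar> \<le> 1")
  case True
  then have "\<bar>x\<bar> ^ j * (1 + x\<^sup>2) \<le> 1 * (1 + 1)"
    by (intro mult_mono power_le_one) (auto simp: abs_square_le_1)
  also have "\<dots> \<le> 2 * (1 + \<bar>x\<bar> ^ k)\<^sup>2"
    by simp
  finally show ?thesis .
next
  case False
  have "1 + x\<^sup>2 \<le> 2 * \<bar>x\<bar>\<^sup>2"
    using False one_le_power[of "\<bar>x\<bar>" 2] by simp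
  moreover have "\<bar>x\<bar> ^ j \<le> \<bar>x\<bar> ^ (k - 1)"
    using False assms by (intro power_increasing) auto
  ultimately have "\<bar>x\<bar> ^ j * (1 + x\<^sup>2) \<le> \<bar>x\<bar> ^ (k - 1) * (2 * \<bar>x\<bar>\<^sup>2)"
    by (intro mult_mono) auto
  also have "\<dots> = 2 * \<bar>x\<bar> ^ (k - 1 + 2)"
    by (simp only: power_add mult_ac)
  also have "\<dots> \<le> 2 * \<bar>x\<bar> ^ (k * 2)"
    using False assms by (intro mult_left_mono power_increasing) auto
  also have "\<dots> \<le> 2 * (1 + \<bar>x\<bar> ^ k)\<^sup>2"
    unfolding power_mult by (intro mult_left_mono power_mono) auto
  finally show ?thesis .
qed

lemma power_factor_nonzero:
  assumes "Im \<alpha> \<noteq> 0"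
  shows "complex_of_real x ^ k - \<alpha> \<noteq> 0"
proof
  assume "complex_of_real x ^ k - \<alpha> = 0"
  then have "\<alpha> = of_real (x ^ k)" by simp
  with assms show False by simp
qed

lemma inverse_power_factor_bound:
  assumes "Im \<alpha> \<noteq> 0"
  obtains C :: real where "C > 0"
    "\<And>x::real. norm (inverse (complex_of_real x ^ k - \<alpha>)) \<le> C / (1 + \<bar>x\<bar> ^ k)"
proof -
  obtain c where c: "c > 0" "\<And>a::real. c * (1 + \<bar>a\<bar>) \<le> cmod (of_real a - \<alpha>)"
    using linear_factor_lower_bound[OF assms] by metis
  show thesis
  proof
    show "inverse c > 0" using c by simp
    fix x :: real
    have "c * (1 + \<bar>x\<bar> ^ k) \<le> cmod (of_real x ^ k - \<alpha>)"
      using c(2)[of "x ^ k"] by (simp add: power_abs)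
    then have "inverse (cmod (of_real x ^ k - \<alpha>)) \<le> inverse (c * (1 + \<bar>x\<bar> ^ k))"
      using c by (intro le_imp_inverse_le mult_pos_pos add_pos_nonneg) auto
    then show "norm (inverse (complex_of_real x ^ k - \<alpha>)) \<le> inverse c / (1 + \<bar>x\<bar> ^ k)"
      by (simp add: norm_inverse divide_inverse)
  qed
qed

text \<open>Written with inverses so that each term contains the decaying product A * B. For k = 1
  the truncated exponent k - 2 is harmless, since its coefficient k - 1 is 0.\<close>

definition rat_kernel_deriv :: "nat \<Rightarrow> complex \<Rightarrow> complex \<Rightarrow> real \<Rightarrow> complex" where
  "rat_kernel_deriv k \<alpha> \<beta> x =
    (let A = inverse (of_real x ^ k - \<alpha>); B = inverse (of_real x ^ k - \<beta>) in
     of_nat (k - 1) * of_real x ^ (k - 2) * A * B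
     - of_nat k * of_real x ^ (k - 1) * of_real x ^ (k - 1) * A * B * (A + B))"

lemma has_vector_derivative_rat_kernel:
  assumes "Im \<alpha> \<noteq> 0" "Im \<beta> \<noteq> 0"
  shows "(rat_kernel k \<alpha> \<beta> has_vector_derivative rat_kernel_deriv k \<alpha> \<beta> x) (at x)"
proof -
  let ?x = "complex_of_real x"
  have inv: "((\<lambda>z. inverse (z ^ k - \<gamma>)) has_field_derivative
      - (inverse (?x ^ k - \<gamma>) * (of_nat k * ?x ^ (k - 1)) * inverse (?x ^ k - \<gamma>))) (at ?x)"
    if "Im \<gamma> \<noteq> 0" for \<gamma>
    using power_factor_nonzero[OF that, of x k]
    by (auto intro!: derivative_eq_intros simp: numeral_2_eq_2)
  have pow: "((\<lambda>z. z ^ (k - 1)) has_field_derivative of_nat (k - 1) * ?x ^ (k - 2)) (at ?x)"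
    by (auto intro!: derivative_eq_intros simp: numeral_2_eq_2)
  have "((\<lambda>z. z ^ (k - 1) * inverse (z ^ k - \<alpha>) * inverse (z ^ k - \<beta>))
      has_field_derivative rat_kernel_deriv k \<alpha> \<beta> x) (at ?x)"
    using DERIV_mult[OF DERIV_mult[OF pow inv[OF assms(1)]] inv[OF assms(2)]]
    unfolding rat_kernel_deriv_def Let_def by (simp add: algebra_simps)
  from has_vector_derivative_real_field[OF this]
  show ?thesis
    by (simp add: rat_kernel_def[abs_def] field_simps)
qed

text \<open>Each inverse factor is O(1 / (1 + \<bar>x\<bar> ^ k)). The product of two of them
  absorbs a power up to k - 1 and still leaves quadratic decay.\<close>

lemma rat_kernel_bounds:
  assumes k: "k > 0" and "Im \<alpha> \<noteq> 0" "Im \<beta> \<noteq> 0"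
  obtains C :: real where "C \<ge> 0"
    "\<And>x. norm (rat_kernel k \<alpha> \<beta> x) \<le> C / (1 + x\<^sup>2)"
    "\<And>x. norm (rat_kernel_deriv k \<alpha> \<beta> x) \<le> C / (1 + x\<^sup>2)"
proof -
  obtain c where c: "c > 0" "\<And>x::real. norm (inverse (complex_of_real x ^ k - \<alpha>)) \<le> c / (1 + \<bar>x\<bar> ^ k)"
    using inverse_power_factor_bound[OF assms(2), of k] by metis
  obtain d where d: "d > 0" "\<And>x::real. norm (inverse (complex_of_real x ^ k - \<beta>)) \<le> d / (1 + \<bar>x\<bar> ^ k)"
    using inverse_power_factor_bound[OF assms(3), of k] by metis
  have AB: "\<bar>x\<bar> ^ j * (norm (inverse (complex_of_real x ^ k - \<alpha>)) * norm (inverse (complex_of_real x ^ k - \<beta>)))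
      \<le> 2 * (c * d) / (1 + x\<^sup>2)" if "j \<le> k - 1" for x j
  proof -
    have "\<bar>x\<bar> ^ j * (norm (inverse (complex_of_real x ^ k - \<alpha>)) * norm (inverse (complex_of_real x ^ k - \<beta>)))
      \<le> \<bar>x\<bar> ^ j * (c / (1 + \<bar>x\<bar> ^ k) * (d / (1 + \<bar>x\<bar> ^ k)))"
      using c d by (intro mult_left_mono mult_mono) auto
    also have "\<dots> = c * d * (\<bar>x\<bar> ^ j / (1 + \<bar>x\<bar> ^ k)\<^sup>2)"
      by (simp add: power2_eq_square)
    also have "\<bar>x\<bar> ^ j / (1 + \<bar>x\<bar> ^ k)\<^sup>2 \<le> 2 / (1 + x\<^sup>2)"
    proof -
      have "1 + \<bar>x\<bar> ^ k > 0" "1 + x\<^sup>2 > 0"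
        by (auto intro!: add_pos_nonneg)
      then show ?thesis
        using power_times_quadratic_le[OF k that, of x] by (simp add: divide_simps)
    qed
    finally show ?thesis
      using c d by (simp add: ac_simps)
  qed
  \<comment> \<open>Differentiating a denominator costs only this extra factor, which is
    bounded.\<close>
  have uA: "\<bar>x\<bar> ^ (k - 1) * norm (inverse (complex_of_real x ^ k - \<alpha>) + inverse (complex_of_real x ^ k - \<beta>))
      \<le> c + d" for x
  proof -
    have m: "1 + \<bar>x\<bar> ^ k > 0"
      by (auto intro!: add_pos_nonneg)
    have "\<bar>x\<bar> ^ (k - 1) \<le> 1 + \<bar>x\<bar> ^ k"
    proof (cases "\<bar>x\<bar> \<le> 1")
      case True
      then show ?thesis
        using power_le_one[of "\<bar>x\<bar>" "k - 1"] by (auto intro!: add_increasing2)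
    next
      case False
      then have "\<bar>x\<bar> ^ (k - 1) \<le> \<bar>x\<bar> ^ k"
        by (intro power_increasing) auto
      then show ?thesis by simp
    qed
    moreover have "norm (inverse (complex_of_real x ^ k - \<alpha>) + inverse (complex_of_real x ^ k - \<beta>))
      \<le> (c + d) / (1 + \<bar>x\<bar> ^ k)"
      using norm_triangle_le[OF add_mono[OF c(2)[of x] d(2)[of x]]] by (simp add: add_divide_distrib)
    ultimately have "\<bar>x\<bar> ^ (k - 1) * norm (inverse (complex_of_real x ^ k - \<alpha>) + inverse (complex_of_real x ^ k - \<beta>))
      \<le> (1 + \<bar>x\<bar> ^ k) * ((c + d) / (1 + \<bar>x\<bar> ^ k))"
      using m by (intro mult_mono) auto
    with m show ?thesis by simp
  qed
  \<comment> \<open>\<open>?K\<close> is the constant for the kernel and \<open>?C\<close> the one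
    for its derivative; the sum serves both.\<close>
  let ?K = "2 * (c * d)"
  let ?C = "real k * ?K + real k * ?K * (c + d)"
  have pos: "?K \<ge> 0" "c + d \<ge> 0" using c d by auto
  show thesis
  proof
    show "?K + ?C \<ge> 0" using pos by auto
    fix x :: real
    have q: "1 + x\<^sup>2 > 0" by (auto intro!: add_pos_nonneg)
    have "norm (rat_kernel k \<alpha> \<beta> x) \<le> ?K / (1 + x\<^sup>2)"
      using AB[of "k - 1" x] by (simp add: rat_kernel_def norm_divide norm_mult norm_power norm_inverse divide_simps)
    also have "\<dots> \<le> (?K + ?C) / (1 + x\<^sup>2)"
      using pos q by (intro divide_right_mono) auto
    finally show "norm (rat_kernel k \<alpha> \<beta> x) \<le> (?K + ?C) / (1 + x\<^sup>2)" .
    let ?A = "inverse (complex_of_real x ^ k - \<alpha>)" and ?B = "inverse (complex_of_real x ^ k - \<beta>)"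
    have "norm (rat_kernel_deriv k \<alpha> \<beta> x) \<le> real (k - 1) * (\<bar>x\<bar> ^ (k - 2) * (norm ?A * norm ?B))
        + real k * (\<bar>x\<bar> ^ (k - 1) * (norm ?A * norm ?B)) * (\<bar>x\<bar> ^ (k - 1) * norm (?A + ?B))"
      unfolding rat_kernel_deriv_def Let_def
      by (rule order_trans[OF norm_triangle_ineq4]) (simp add: norm_mult norm_power ac_simps)
    also have "\<dots> \<le> real k * (?K / (1 + x\<^sup>2)) + real k * (?K / (1 + x\<^sup>2)) * (c + d)"
      using c(1) d(1) q
      by (intro add_mono mult_mono AB uA mult_nonneg_nonneg divide_nonneg_pos) auto
    also have "\<dots> = ?C / (1 + x\<^sup>2)"
      by (simp add: add_divide_distrib)
    also have "\<dots> \<le> (?K + ?C) / (1 + x\<^sup>2)"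
      using pos q by (intro divide_right_mono) auto
    finally show "norm (rat_kernel_deriv k \<alpha> \<beta> x) \<le> (?K + ?C) / (1 + x\<^sup>2)" .
  qed
qed

lemma continuous_rat_kernel:
  assumes "Im \<alpha> \<noteq> 0" "Im \<beta> \<noteq> 0"
  shows "continuous_on UNIV (rat_kernel k \<alpha> \<beta>)" "continuous_on UNIV (rat_kernel_deriv k \<alpha> \<beta>)"
  unfolding rat_kernel_def[abs_def] rat_kernel_deriv_def[abs_def] Let_def
  by (intro continuous_intros ballI; use power_factor_nonzero assms in force)+

text \<open>The weight sqrt \<bar>x\<bar> is the price of the square-root bound for the character.
  At infinity the quotient decays like \<bar>x\<bar> powr (-3/2); near 0 it is bounded, and
  \<bar>x\<bar> powr (-1/2) is a convenient integrable majorant.\<close>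

lemma integrable_sqrt_over_quadratic:
  "integrable lborel (\<lambda>x::real. (1 + sqrt \<bar>x\<bar>) / (1 + x\<^sup>2))"
proof (rule Bochner_Integration.integrable_bound)
  show "integrable lborel (\<lambda>x::real. 2 * (if \<bar>x\<bar> \<le> 1 then \<bar>x\<bar> powr (-1/2) else \<bar>x\<bar> powr (-3/2)))"
    by (intro integrable_mult_right integrable_two_powers) auto
  show "AE x in lborel. norm ((1 + sqrt \<bar>x\<bar>) / (1 + x\<^sup>2))
      \<le> norm (2 * (if \<bar>x\<bar> \<le> 1 then \<bar>x\<bar> powr (-1/2) else \<bar>x\<bar> powr (-3/2)))"
    using AE_lborel_singleton[of "0::real"]
  proof eventually_elim
    case (elim x)
    have q: "1 + x\<^sup>2 > 0" by (auto intro!: add_pos_nonneg)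
    show ?case
    proof (cases "\<bar>x\<bar> \<le> 1")
      case True
      have s: "0 < sqrt \<bar>x\<bar>" "sqrt \<bar>x\<bar> \<le> 1" using True elim by auto
      have "(1 + sqrt \<bar>x\<bar>) / (1 + x\<^sup>2) \<le> 2 / 1"
        using s by (intro frac_le) auto
      also have "\<dots> \<le> 2 * (1 / sqrt \<bar>x\<bar>)"
      proof -
        have "1 \<le> 1 / sqrt \<bar>x\<bar>"
          using s by (subst le_divide_eq_1_pos)
        then show ?thesis by linarith
      qed
      finally show ?thesis
        using True elim q by (simp add: powr_minus_divide powr_half_sqrt abs_mult)
    next
      case False
      then have s: "sqrt \<bar>x\<bar> \<ge> 1" by simp
      have "\<bar>x\<bar> powr (3/2) = \<bar>x\<bar> powr (1 + 1/2)" by simp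
      also have "\<dots> = \<bar>x\<bar> * sqrt \<bar>x\<bar>"
        using elim by (subst powr_add) (simp add: powr_half_sqrt)
      finally have p: "\<bar>x\<bar> powr (3/2) = \<bar>x\<bar> * sqrt \<bar>x\<bar>" .
      have "(1 + sqrt \<bar>x\<bar>) * (\<bar>x\<bar> * sqrt \<bar>x\<bar>) \<le> (2 * sqrt \<bar>x\<bar>) * (\<bar>x\<bar> * sqrt \<bar>x\<bar>)"
        using s by (intro mult_right_mono) auto
      also have "\<dots> = 2 * (\<bar>x\<bar> * (sqrt \<bar>x\<bar> * sqrt \<bar>x\<bar>))"
        by (simp only: ac_simps)
      also have "\<dots> = 2 * x\<^sup>2"
        by (simp add: power2_eq_square)
      also have "\<dots> \<le> 2 * (1 + x\<^sup>2)" by simp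
      finally have "(1 + sqrt \<bar>x\<bar>) / (1 + x\<^sup>2) \<le> 2 / (\<bar>x\<bar> * sqrt \<bar>x\<bar>)"
        using q elim by (simp add: divide_simps)
      then show ?thesis
        using False elim q by (simp add: powr_minus_divide p abs_mult)
    qed
  qed
qed auto

text \<open>Both functions are dominated by C * (1 + sqrt \<bar>x\<bar>) / (1 + x^2).\<close>

lemma integrable_over_quadratic:
  fixes h :: "real \<Rightarrow> complex"
  assumes "continuous_on UNIV h" "\<And>x. norm (h x) \<le> C / (1 + x\<^sup>2)" "C \<ge> 0"
  shows "integrable lborel h" "integrable lborel (\<lambda>x. sqrt \<bar>x\<bar> * norm (h x))"
proof -
  have [measurable]: "h \<in> borel_measurable borel"
    using assms(1) by (rule borel_measurable_continuous_onI)
  have I: "integrable lborel (\<lambda>x::real. C * ((1 + sqrt \<bar>x\<bar>) / (1 + x\<^sup>2)))"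
    by (intro integrable_mult_right integrable_sqrt_over_quadratic)
  have q: "1 + x\<^sup>2 > 0" for x :: real by (auto intro!: add_pos_nonneg)
  have B: "0 \<le> C * ((1 + sqrt \<bar>x\<bar>) / (1 + x\<^sup>2))"
    "(1 + sqrt \<bar>x\<bar>) * norm (h x) \<le> C * ((1 + sqrt \<bar>x\<bar>) / (1 + x\<^sup>2))" for x
    using mult_left_mono[OF assms(2)[of x], of "1 + sqrt \<bar>x\<bar>"] assms(3) q[of x]
    by (auto simp: ac_simps)
  have "norm (h x) \<le> (1 + sqrt \<bar>x\<bar>) * norm (h x)"
    "sqrt \<bar>x\<bar> * norm (h x) \<le> (1 + sqrt \<bar>x\<bar>) * norm (h x)" for x
    by (auto simp: algebra_simps)
  then have "norm (h x) \<le> C * ((1 + sqrt \<bar>x\<bar>) / (1 + x\<^sup>2))"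
    "sqrt \<bar>x\<bar> * norm (h x) \<le> C * ((1 + sqrt \<bar>x\<bar>) / (1 + x\<^sup>2))" for x
    using B(2)[of x] order_trans by blast+
  then have "norm (h x) \<le> norm (C * ((1 + sqrt \<bar>x\<bar>) / (1 + x\<^sup>2)))"
    "norm (sqrt \<bar>x\<bar> * norm (h x)) \<le> norm (C * ((1 + sqrt \<bar>x\<bar>) / (1 + x\<^sup>2)))" for x
    using assms(3) by (auto simp: abs_mult)
  then show "integrable lborel h" "integrable lborel (\<lambda>x. sqrt \<bar>x\<bar> * norm (h x))"
    by (intro Bochner_Integration.integrable_bound[OF I] AE_I2; measurable)+
qed

lemma integrable_rat_kernel:
  assumes "k > 0" "Im \<alpha> \<noteq> 0" "Im \<beta> \<noteq> 0"
  shows "integrable lborel (rat_kernel k \<alpha> \<beta>)"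
proof -
  obtain C where "C \<ge> 0" "\<And>x. norm (rat_kernel k \<alpha> \<beta> x) \<le> C / (1 + x\<^sup>2)"
    using rat_kernel_bounds[OF assms] by metis
  then show ?thesis
    using continuous_rat_kernel(1)[OF assms(2,3)] by (intro integrable_over_quadratic)
qed

text \<open>The antiderivative of the integrand is a multiple of \<open>Log ((x ^ k - \<alpha>) / (x ^ k - \<beta>))\<close>. Since
  \<open>\<alpha>\<close> and \<open>\<beta>\<close> lie in the same half-plane, the quotient never meets the branch cut; it tends to 1 at
  both ends.\<close>
lemma integral_rat_kernel_eq_0:
  assumes k: "k > 0" and im: "Im \<alpha> \<noteq> 0" "Im \<beta> \<noteq> 0"
    and sgn: "sgn (Im \<alpha>) = sgn (Im \<beta>)" and ne: "\<alpha> \<noteq> \<beta>"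
  shows "integral\<^sup>L lborel (rat_kernel k \<alpha> \<beta>) = 0"
proof (rule integral_derivative_eq_0)
  let ?c = "of_nat k * (\<alpha> - \<beta>)"
  let ?F = "\<lambda>z. Ln ((z ^ k - \<alpha>) / (z ^ k - \<beta>)) / ?c"
  have nz: "complex_of_real x ^ k - \<alpha> \<noteq> 0" "complex_of_real x ^ k - \<beta> \<noteq> 0" for x
    using power_factor_nonzero im by auto
  have cut: "(complex_of_real x ^ k - \<alpha>) / (complex_of_real x ^ k - \<beta>) \<notin> \<real>\<^sub>\<le>\<^sub>0" for x
  proof
    assume "(complex_of_real x ^ k - \<alpha>) / (complex_of_real x ^ k - \<beta>) \<in> \<real>\<^sub>\<le>\<^sub>0"
    then obtain r where r: "r \<le> 0" "(complex_of_real x ^ k - \<alpha>) / (complex_of_real x ^ k - \<beta>) = of_real r"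
      by (auto elim: nonpos_Reals_cases)
    then have "complex_of_real (x ^ k) - \<alpha> = of_real r * (of_real (x ^ k) - \<beta>)"
      using nz(2)[of x] by (simp add: field_simps)
    \<comment> \<open>As x ^ k is real, a real quotient r must equal Im \<alpha> / Im \<beta>, which
      is positive.\<close>
    from arg_cong[OF this, of Im] have "Im \<alpha> = r * Im \<beta>"
      by simp
    then show False
      using sgn im r by (auto simp: sgn_if mult_le_0_iff zero_less_mult_iff split: if_splits)
  qed
  show "((\<lambda>x. ?F (complex_of_real x)) has_vector_derivative rat_kernel k \<alpha> \<beta> x) (at x)" for x
  proof (rule has_vector_derivative_real_field)
    have "((\<lambda>z. (z ^ k - \<alpha>) / (z ^ k - \<beta>)) has_field_derivative
        of_nat k * of_real x ^ (k - 1) * (\<alpha> - \<beta>) / (of_real x ^ k - \<beta>)\<^sup>2) (at (complex_of_real x))"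
      using nz[of x] by (auto intro!: derivative_eq_intros simp: field_simps power2_eq_square)
    from has_field_derivative_Ln[OF cut, of x] this
    have "((\<lambda>z. Ln ((z ^ k - \<alpha>) / (z ^ k - \<beta>))) has_field_derivative
       inverse ((of_real x ^ k - \<alpha>) / (of_real x ^ k - \<beta>)) *
       (of_nat k * of_real x ^ (k - 1) * (\<alpha> - \<beta>) / (of_real x ^ k - \<beta>)\<^sup>2)) (at (complex_of_real x))"
      by (rule DERIV_chain2)
    then have "(?F has_field_derivative
       inverse ((of_real x ^ k - \<alpha>) / (of_real x ^ k - \<beta>)) *
       (of_nat k * of_real x ^ (k - 1) * (\<alpha> - \<beta>) / (of_real x ^ k - \<beta>)\<^sup>2) / ?c) (at (complex_of_real x))"
      by (rule DERIV_cdivide)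
    moreover have "inverse ((of_real x ^ k - \<alpha>) / (of_real x ^ k - \<beta>)) *
       (of_nat k * of_real x ^ (k - 1) * (\<alpha> - \<beta>) / (of_real x ^ k - \<beta>)\<^sup>2) / ?c = rat_kernel k \<alpha> \<beta> x"
      using nz[of x] k ne by (simp add: rat_kernel_def divide_simps power2_eq_square)
    ultimately show "(?F has_field_derivative rat_kernel k \<alpha> \<beta> x) (at (complex_of_real x))"
      by simp
  qed
  \<comment> \<open>Both ends of the line are covered by one argument in which only \<bar>x\<bar>
    tends to infinity.\<close>
  have lim: "((\<lambda>x. ?F (complex_of_real x)) \<longlongrightarrow> 0) G" if G: "filterlim (\<lambda>x::real. \<bar>x\<bar>) at_top G" for G
  proof -
    have *: "filterlim (\<lambda>x. complex_of_real x ^ k - \<beta>) at_infinity G"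
    proof -
      have "filterlim complex_of_real at_infinity G"
        using G by (intro filterlim_norm_at_top_imp_at_infinity) simp
      then have "filterlim (\<lambda>x. complex_of_real x ^ k) at_infinity G"
        using k by (intro Limits.filterlim_power_at_infinity) auto
      from tendsto_add_filterlim_at_infinity'[OF this tendsto_const[of "- \<beta>"]]
      show ?thesis by simp
    qed
    have "((\<lambda>x. 1 + (\<beta> - \<alpha>) / (complex_of_real x ^ k - \<beta>)) \<longlongrightarrow> 1 + 0) G"
      by (intro tendsto_intros tendsto_divide_0[OF tendsto_const *])
    moreover have "1 + (\<beta> - \<alpha>) / (complex_of_real x ^ k - \<beta>)
        = (complex_of_real x ^ k - \<alpha>) / (complex_of_real x ^ k - \<beta>)" for x
      using nz[of x] by (simp add: field_simps)
    ultimately have "((\<lambda>x. (complex_of_real x ^ k - \<alpha>) / (complex_of_real x ^ k - \<beta>)) \<longlongrightarrow> 1) G"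
      by simp
    then have "((\<lambda>x. Ln ((complex_of_real x ^ k - \<alpha>) / (complex_of_real x ^ k - \<beta>)) / ?c) \<longlongrightarrow> Ln 1 / ?c) G"
      using ne k by (intro tendsto_intros) auto
    then show ?thesis by simp
  qed
  show "((\<lambda>x. ?F (complex_of_real x)) \<longlongrightarrow> 0) at_top" "((\<lambda>x. ?F (complex_of_real x)) \<longlongrightarrow> 0) at_bot"
    by (intro lim; real_asymp)+
  show "isCont (rat_kernel k \<alpha> \<beta>) x" for x
    using continuous_rat_kernel(1)[OF im, of k] by (simp add: continuous_on_eq_continuous_at)
  show "integrable lborel (rat_kernel k \<alpha> \<beta>)"
    by (rule integrable_rat_kernel[OF k im])
qed

text \<open>For small \<open>s\<close> the bound comes from the vanishing integral of the kernel,
  for large \<open>s\<close> from one integration by parts. Together they make the later integral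
  against dy / \<bar>y\<bar> converge at 0 and at infinity.\<close>

lemma kernel_bound:
  assumes k: "k > 0" and im: "Im \<alpha> \<noteq> 0" "Im \<beta> \<noteq> 0"
    and sgn: "sgn (Im \<alpha>) = sgn (Im \<beta>)" and ne: "\<alpha> \<noteq> \<beta>"
  obtains C :: real where "C \<ge> 0"
    "\<And>s. norm (\<integral>x. fchar (s * x) * rat_kernel k \<alpha> \<beta> x \<partial>lborel) \<le> C * min (sqrt \<bar>s\<bar>) (1 / \<bar>s\<bar>)"
proof -
  obtain C where C: "C \<ge> 0" "\<And>x. norm (rat_kernel k \<alpha> \<beta> x) \<le> C / (1 + x\<^sup>2)"
      "\<And>x. norm (rat_kernel_deriv k \<alpha> \<beta> x) \<le> C / (1 + x\<^sup>2)"
    using rat_kernel_bounds[OF k im] by metis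
  note cont = continuous_rat_kernel[OF im, of k]
  have [measurable]: "rat_kernel k \<alpha> \<beta> \<in> borel_measurable borel" "rat_kernel_deriv k \<alpha> \<beta> \<in> borel_measurable borel"
    using cont by (auto intro: borel_measurable_continuous_onI)
  note I = integrable_over_quadratic[OF cont(1) C(2,1)] integrable_over_quadratic(1)[OF cont(2) C(3,1)]
  have Ie: "integrable lborel (\<lambda>x. fchar (s * x) * rat_kernel k \<alpha> \<beta> x)" for s
    by (rule Bochner_Integration.integrable_bound[OF I(1)]) (auto simp: norm_mult)
  have Ie': "integrable lborel (\<lambda>x. fchar (s * x) * rat_kernel_deriv k \<alpha> \<beta> x)" for s
    by (rule Bochner_Integration.integrable_bound[OF I(3)]) (auto simp: norm_mult)
  define \<Phi> where "\<Phi> s = (\<integral>x. fchar (s * x) * rat_kernel k \<alpha> \<beta> x \<partial>lborel)" for s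
  define C1 where "C1 = 4 * (\<integral>x. sqrt \<bar>x\<bar> * norm (rat_kernel k \<alpha> \<beta> x) \<partial>lborel)"
  define C2 where "C2 = (\<integral>x. norm (rat_kernel_deriv k \<alpha> \<beta> x) \<partial>lborel)"
  have pos: "C1 \<ge> 0" "C2 \<ge> 0"
    by (auto simp: C1_def C2_def)
  have 1: "norm (\<Phi> s) \<le> C1 * sqrt \<bar>s\<bar>" for s
  proof -
    \<comment> \<open>Subtracting the kernel, whose integral is 0, replaces the character by its
      difference from 1.\<close>
    have "\<Phi> s = (\<integral>x. fchar (s * x) * rat_kernel k \<alpha> \<beta> x - rat_kernel k \<alpha> \<beta> x \<partial>lborel)"
      using Ie[of s] I(1) integral_rat_kernel_eq_0[OF assms] by (simp add: \<Phi>_def)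
    also have "norm \<dots> \<le> (\<integral>x. (4 * sqrt \<bar>s\<bar>) * (sqrt \<bar>x\<bar> * norm (rat_kernel k \<alpha> \<beta> x)) \<partial>lborel)"
    proof (rule Bochner_Integration.integral_norm_bound_integral)
      fix x :: real
      have "norm (fchar (s * x) * rat_kernel k \<alpha> \<beta> x - rat_kernel k \<alpha> \<beta> x) = norm (fchar (s * x) - 1) * norm (rat_kernel k \<alpha> \<beta> x)"
        by (simp add: algebra_simps flip: norm_mult)
      also have "\<dots> \<le> (4 * sqrt \<bar>s * x\<bar>) * norm (rat_kernel k \<alpha> \<beta> x)"
        by (intro mult_right_mono norm_fchar_minus_1_le) auto
      finally show "norm (fchar (s * x) * rat_kernel k \<alpha> \<beta> x - rat_kernel k \<alpha> \<beta> x) \<le> (4 * sqrt \<bar>s\<bar>) * (sqrt \<bar>x\<bar> * norm (rat_kernel k \<alpha> \<beta> x))"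
        by (simp add: abs_mult real_sqrt_mult)
    qed (use Ie I in auto)
    also have "\<dots> = C1 * sqrt \<bar>s\<bar>"
      by (simp add: C1_def)
    finally show ?thesis .
  qed
  have 2: "\<bar>s\<bar> * norm (\<Phi> s) \<le> C2" for s
  proof -
    \<comment> \<open>\<open>?D\<close> is the derivative of the character times the kernel, so its
      integral vanishes.\<close>
    let ?D = "\<lambda>x. - (2 * pi * \<i> * s) * (fchar (s * x) * rat_kernel k \<alpha> \<beta> x) + fchar (s * x) * rat_kernel_deriv k \<alpha> \<beta> x"
    have "integral\<^sup>L lborel ?D = 0"
    proof (rule integral_derivative_eq_0)
      show "((\<lambda>x. fchar (s * x) * rat_kernel k \<alpha> \<beta> x) has_vector_derivative ?D x) (at x)" for x
        using has_vector_derivative_mult[OF has_vector_derivative_fchar[of s 0 x] has_vector_derivative_rat_kernel[OF im, of k x]]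
        by (simp add: algebra_simps)
      have "continuous_on UNIV ?D"
        by (intro continuous_intros cont continuous_on_compose2[OF continuous_fchar]) auto
      then show "isCont ?D x" for x
        by (simp add: continuous_on_eq_continuous_at)
      show "integrable lborel ?D"
        using Ie Ie' by auto
      have lim: "((\<lambda>x. fchar (s * x) * rat_kernel k \<alpha> \<beta> x) \<longlongrightarrow> 0) G"
        if "((\<lambda>x. C / (1 + x\<^sup>2)) \<longlongrightarrow> 0) G" for G
        by (rule Lim_null_comparison[OF _ that]) (use C in \<open>auto simp: norm_mult\<close>)
      have "((\<lambda>x::real. C / (1 + x\<^sup>2)) \<longlongrightarrow> 0) at_top" "((\<lambda>x::real. C / (1 + x\<^sup>2)) \<longlongrightarrow> 0) at_bot"
        by real_asymp+
      then show "((\<lambda>x. fchar (s * x) * rat_kernel k \<alpha> \<beta> x) \<longlongrightarrow> 0) at_top"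
        "((\<lambda>x. fchar (s * x) * rat_kernel k \<alpha> \<beta> x) \<longlongrightarrow> 0) at_bot"
        using lim by auto
    qed
    moreover have "integral\<^sup>L lborel ?D = - (2 * pi * \<i> * s) * \<Phi> s + (\<integral>x. fchar (s * x) * rat_kernel_deriv k \<alpha> \<beta> x \<partial>lborel)"
      using Ie Ie' by (simp add: \<Phi>_def)
    ultimately have "(2 * pi * \<i> * s) * \<Phi> s = (\<integral>x. fchar (s * x) * rat_kernel_deriv k \<alpha> \<beta> x \<partial>lborel)"
      by simp
    then have "2 * pi * (\<bar>s\<bar> * norm (\<Phi> s)) = norm (\<integral>x. fchar (s * x) * rat_kernel_deriv k \<alpha> \<beta> x \<partial>lborel)"
      by (simp add: norm_mult flip: \<open>_ = (\<integral>x. fchar (s * x) * rat_kernel_deriv k \<alpha> \<beta> x \<partial>lborel)\<close>)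
    also have "\<dots> \<le> C2"
      unfolding C2_def using Ie' I
      by (intro Bochner_Integration.integral_norm_bound_integral) (auto simp: norm_mult)
    finally have "2 * pi * (\<bar>s\<bar> * norm (\<Phi> s)) \<le> C2" .
    moreover have "1 * (\<bar>s\<bar> * norm (\<Phi> s)) \<le> 2 * pi * (\<bar>s\<bar> * norm (\<Phi> s))"
      using pi_gt3 by (intro mult_right_mono) auto
    ultimately show ?thesis by simp
  qed
  show thesis
  proof
    show "C1 + C2 \<ge> 0" using pos by simp
    fix s :: real
    have "norm (\<Phi> s) \<le> (C1 + C2) * sqrt \<bar>s\<bar>"
      using 1[of s] pos by (intro order_trans[OF 1] mult_right_mono) auto
    moreover have "norm (\<Phi> s) \<le> (C1 + C2) * (1 / \<bar>s\<bar>)"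
    proof (cases "s = 0")
      \<comment> \<open>Here 1 / \<bar>s\<bar> = 0, so the claim is that \<Phi> vanishes at 0; the
        square-root bound supplies it.\<close>
      case True
      then show ?thesis using 1[of 0] by simp
    next
      case False
      then show ?thesis using 2[of s] pos by (simp add: field_simps)
    qed
    ultimately show "norm (\<integral>x. fchar (s * x) * rat_kernel k \<alpha> \<beta> x \<partial>lborel) \<le> (C1 + C2) * min (sqrt \<bar>s\<bar>) (1 / \<bar>s\<bar>)"
      by (simp add: \<Phi>_def min_def)
  qed
qed

section \<open>Test functions and their Fourier transforms\<close>

lemma test_fun_differentiable: "test_fun h \<Longrightarrow> h differentiable (at z)"
  unfolding test_fun_def smooth2_def using pderivs.base by blast

lemma test_fun_continuous: "test_fun h \<Longrightarrow> continuous_on UNIV h"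
  by (metis test_fun_differentiable differentiable_imp_continuous_within continuous_at_imp_continuous_on)

text \<open>This is how smoothness passes from a function to its partial derivatives.\<close>

lemma pderivs_trans: "u \<in> pderivs h \<Longrightarrow> h \<in> pderivs f \<Longrightarrow> u \<in> pderivs f"
  by (induction rule: pderivs.induct) (auto intro: pderivs.intros)

text \<open>The operator \<open>vector_derivative\<close> is meaningful only where a derivative
  exists. Frechet differentiability, composed with the affine embedding of a coordinate line,
  provides it.\<close>

lemma has_vector_derivative_partials:
  assumes "test_fun h"
  shows "((\<lambda>x. h (x, y)) has_vector_derivative partial1 h (x, y)) (at x)"
    and "((\<lambda>y. h (x, y)) has_vector_derivative partial2 h (x, y)) (at y)"
proof -
  have "(h \<circ> (\<lambda>x. (x, y))) differentiable (at x)"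
    by (intro differentiable_chain_at test_fun_differentiable assms differentiable_Pair) auto
  then show "((\<lambda>x. h (x, y)) has_vector_derivative partial1 h (x, y)) (at x)"
    by (simp add: partial1_def o_def vector_derivative_works)
  have "(h \<circ> (\<lambda>y. (x, y))) differentiable (at y)"
    by (intro differentiable_chain_at test_fun_differentiable assms differentiable_Pair) auto
  then show "((\<lambda>y. h (x, y)) has_vector_derivative partial2 h (x, y)) (at y)"
    by (simp add: partial2_def o_def vector_derivative_works)
qed

text \<open>The complement of the support is open, so \<open>h\<close> vanishes on a whole
  neighbourhood of the point along each coordinate line.\<close>

lemma partials_zero_outside_support:
  assumes "z \<notin> closure {z. h z \<noteq> 0}"
  shows "partial1 h z = 0" "partial2 h z = 0"
proof -
  obtain x y where z: "z = (x, y)" by (cases z)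
  let ?U = "- closure {z. h z \<noteq> 0}"
  have U: "open ?U" "(x, y) \<in> ?U" using assms z by auto
  have h0: "h w = 0" if "w \<in> ?U" for w
    using that closure_subset[of "{z. h z \<noteq> 0}"] by auto
  have o: "open ((\<lambda>t. (t, y)) -` ?U)" "open ((\<lambda>t. (x, t)) -` ?U)"
    by (rule open_vimage[OF U(1)], intro continuous_intros)+
  have "((\<lambda>t. h (t, y)) has_vector_derivative 0) (at x)"
    by (rule has_vector_derivative_transform_within_open[OF has_vector_derivative_const[of 0] o(1)];
        (rule h0[symmetric])?; use U(2) in simp)
  moreover have "((\<lambda>t. h (x, t)) has_vector_derivative 0) (at y)"
    by (rule has_vector_derivative_transform_within_open[OF has_vector_derivative_const[of 0] o(2)];
        (rule h0[symmetric])?; use U(2) in simp)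
  ultimately
  show "partial1 h z = 0" "partial2 h z = 0"
    by (auto simp: partial1_def partial2_def z intro: vector_derivative_at)
qed

lemma test_fun_partials:
  assumes "test_fun h"
  shows "test_fun (partial1 h)" "test_fun (partial2 h)"
proof -
  have "{z. partial1 h z \<noteq> 0} \<subseteq> closure {z. h z \<noteq> 0}" "{z. partial2 h z \<noteq> 0} \<subseteq> closure {z. h z \<noteq> 0}"
    using partials_zero_outside_support by blast+
  then have "closure {z. partial1 h z \<noteq> 0} \<subseteq> closure {z. h z \<noteq> 0}"
    "closure {z. partial2 h z \<noteq> 0} \<subseteq> closure {z. h z \<noteq> 0}"
    by (simp_all add: closure_minimal)
  then have "compact (closure {z. partial1 h z \<noteq> 0})" "compact (closure {z. partial2 h z \<noteq> 0})"
    using assms bounded_subset[of "closure {z. h z \<noteq> 0}"]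
    by (simp_all add: test_fun_def compact_eq_bounded_closed)
  moreover have "smooth2 (partial1 h)" "smooth2 (partial2 h)"
    using assms pderivs_trans[OF _ pderivs.d1[OF pderivs.base]] pderivs_trans[OF _ pderivs.d2[OF pderivs.base]]
    unfolding test_fun_def smooth2_def by metis+
  ultimately show "test_fun (partial1 h)" "test_fun (partial2 h)"
    by (auto simp: test_fun_def)
qed

lemma test_fun_partials_funpow:
  assumes "test_fun h"
  shows "test_fun ((partial1 ^^ n) h)" "test_fun ((partial2 ^^ n) h)"
  using assms by (induction n) (auto intro: test_fun_partials)

lemma integrable_compact_support:
  fixes h :: "real \<times> real \<Rightarrow> complex"
  assumes "continuous_on UNIV h" "compact (closure {z. h z \<noteq> 0})"
  shows "integrable lborel h"
proof -
  have "integrable lborel (\<lambda>x. indicator (closure {z. h z \<noteq> 0}) x *\<^sub>R h x)"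
    using assms by (intro borel_integrable_compact) (auto intro: continuous_on_subset)
  moreover have "indicator (closure {z. h z \<noteq> 0}) x *\<^sub>R h x = h x" for x
    using closure_subset[of "{z. h z \<noteq> 0}"] by (auto simp: indicator_def)
  ultimately show ?thesis by simp
qed

lemma test_fun_integrable: "test_fun h \<Longrightarrow> integrable lborel h"
  by (intro integrable_compact_support test_fun_continuous) (auto simp: test_fun_def)

section \<open>Fourier transforms of partial derivatives\<close>

lemma fourier2_eq: "fourier2 h (\<xi>, \<eta>) = (\<integral>z. h z * fchar (fst z * \<xi> + snd z * \<eta>) \<partial>lborel)"
  by (simp add: fourier2_def fchar_def case_prod_unfold)

lemma integrable_times_fchar:
  assumes "integrable lborel h"
  shows "integrable lborel (\<lambda>z::real \<times> real. h z * fchar (fst z * \<xi> + snd z * \<eta>))"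
proof (rule Bochner_Integration.integrable_bound[OF assms])
  have [measurable]: "h \<in> borel_measurable borel"
    using borel_measurable_integrable[OF assms] by simp
  have "(\<lambda>z::real \<times> real. fchar (fst z * \<xi> + snd z * \<eta>)) \<in> borel_measurable borel"
    by (intro borel_measurable_continuous_onI continuous_on_compose2[OF continuous_fchar] continuous_intros) auto
  then show "(\<lambda>z::real \<times> real. h z * fchar (fst z * \<xi> + snd z * \<eta>)) \<in> borel_measurable lborel"
    by simp
qed (auto simp: norm_mult)

lemma tendsto_0_compact_support:
  fixes h :: "real \<times> real \<Rightarrow> complex"
  assumes "compact (closure {z. h z \<noteq> 0})"
  shows "((\<lambda>x. h (x, y)) \<longlongrightarrow> 0) at_infinity" "((\<lambda>y. h (x, y)) \<longlongrightarrow> 0) at_infinity"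
proof -
  obtain R where R: "\<And>z. h z \<noteq> 0 \<Longrightarrow> norm z \<le> R"
    using compact_imp_bounded[OF assms] closure_subset[of "{z. h z \<noteq> 0}"]
    unfolding bounded_iff by blast
  have "h (x, y) = 0" if "norm x \<ge> R + 1" for x y
  proof (rule ccontr)
    assume "h (x, y) \<noteq> 0"
    from R[OF this] norm_fst_le[of x y] that show False by simp
  qed
  then show "((\<lambda>x. h (x, y)) \<longlongrightarrow> 0) at_infinity"
    by (intro tendsto_eventually) (auto simp: eventually_at_infinity)
  have "h (x, y) = 0" if "norm y \<ge> R + 1" for x y
  proof (rule ccontr)
    assume "h (x, y) \<noteq> 0"
    from R[OF this] norm_snd_le[of y x] that show False by simp
  qed
  then show "((\<lambda>y. h (x, y)) \<longlongrightarrow> 0) at_infinity"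
    by (intro tendsto_eventually) (auto simp: eventually_at_infinity)
qed

text \<open>By Fubini, integrate first in the variable of differentiation; compact support removes
  the boundary terms.\<close>

lemma integral_partial_derivative_eq_0:
  fixes u u1 u2 :: "real \<times> real \<Rightarrow> complex"
  assumes supp: "compact (closure {z. u z \<noteq> 0})"
  shows "\<lbrakk>\<And>x y. ((\<lambda>x. u (x, y)) has_vector_derivative u1 (x, y)) (at x);
      continuous_on UNIV u1; integrable lborel u1\<rbrakk> \<Longrightarrow> integral\<^sup>L lborel u1 = 0"
    and "\<lbrakk>\<And>x y. ((\<lambda>y. u (x, y)) has_vector_derivative u2 (x, y)) (at y);
      continuous_on UNIV u2; integrable lborel u2\<rbrakk> \<Longrightarrow> integral\<^sup>L lborel u2 = 0"
proof -
  have top_bot: "(at_top :: real filter) \<le> at_infinity" "(at_bot :: real filter) \<le> at_infinity"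
    by (rule at_top_le_at_infinity at_bot_le_at_infinity)+
  {
    assume d: "\<And>x y. ((\<lambda>x. u (x, y)) has_vector_derivative u1 (x, y)) (at x)"
      and c: "continuous_on UNIV u1" and i: "integrable lborel u1"
    have i': "integrable (lborel \<Otimes>\<^sub>M lborel) (case_prod (\<lambda>x y. u1 (x, y)))"
      using i by (simp add: lborel_prod)
    \<comment> \<open>Fubini gives integrable slices for almost every y only, which suffices for the
      outer integral.\<close>
    have "(\<integral>x. u1 (x, y) \<partial>lborel) = 0" if "integrable lborel (\<lambda>x. u1 (x, y))" for y
    proof (rule integral_derivative_eq_0[OF d _ that])
      have "continuous_on UNIV (\<lambda>x. u1 (x, y))"
        by (intro continuous_on_compose2[OF c] continuous_intros) auto
      then show "isCont (\<lambda>x. u1 (x, y)) x" for x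
        by (simp add: continuous_on_eq_continuous_at)
    qed (use tendsto_0_compact_support(1)[OF supp] tendsto_mono top_bot in blast)+
    then have "AE y in lborel. (\<integral>x. u1 (x, y) \<partial>lborel) = 0"
      using lborel_pair.AE_integrable_snd[OF i'] by (auto elim: eventually_mono)
    then have "(\<integral>y. (\<integral>x. u1 (x, y) \<partial>lborel) \<partial>lborel) = 0"
      by (rule integral_eq_zero_AE)
    then show "integral\<^sup>L lborel u1 = 0"
      using lborel_pair.integral_snd[OF i'] by (simp add: lborel_prod)
  next
    assume d: "\<And>x y. ((\<lambda>y. u (x, y)) has_vector_derivative u2 (x, y)) (at y)"
      and c: "continuous_on UNIV u2" and i: "integrable lborel u2"
    have i': "integrable (lborel \<Otimes>\<^sub>M lborel) (case_prod (\<lambda>x y. u2 (x, y)))"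
      using i by (simp add: lborel_prod)
    have "(\<integral>y. u2 (x, y) \<partial>lborel) = 0" if "integrable lborel (\<lambda>y. u2 (x, y))" for x
    proof (rule integral_derivative_eq_0[OF d _ that])
      have "continuous_on UNIV (\<lambda>y. u2 (x, y))"
        by (intro continuous_on_compose2[OF c] continuous_intros) auto
      then show "isCont (\<lambda>y. u2 (x, y)) y" for y
        by (simp add: continuous_on_eq_continuous_at)
    qed (use tendsto_0_compact_support(2)[OF supp] tendsto_mono top_bot in blast)+
    then have "AE x in lborel. (\<integral>y. u2 (x, y) \<partial>lborel) = 0"
      using lborel_pair.AE_integrable_fst[OF i'] by (auto elim: eventually_mono)
    then have "(\<integral>x. (\<integral>y. u2 (x, y) \<partial>lborel) \<partial>lborel) = 0"
      by (rule integral_eq_zero_AE)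
    then show "integral\<^sup>L lborel u2 = 0"
      using lborel_pair.integral_fst[OF i'] by (simp add: lborel_prod)
  }
qed

text \<open>Integration by parts: the derivative of \<open>h\<close> times the exponential
  integrates to 0, and its two terms are the two sides of the claim.\<close>

lemma fourier2_partials:
  assumes h: "test_fun h"
  shows "fourier2 (partial1 h) (\<xi>, \<eta>) = (2 * pi * \<i> * \<xi>) * fourier2 h (\<xi>, \<eta>)"
    and "fourier2 (partial2 h) (\<xi>, \<eta>) = (2 * pi * \<i> * \<eta>) * fourier2 h (\<xi>, \<eta>)"
proof -
  define e where "e = (\<lambda>z::real \<times> real. fchar (fst z * \<xi> + snd z * \<eta>))"
  have e_nz: "e z \<noteq> 0" for z
    by (simp add: e_def fchar_def)
  have e_cont: "continuous_on UNIV e"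
    unfolding e_def by (intro continuous_on_compose2[OF continuous_fchar] continuous_intros) auto
  \<comment> \<open>The exponential has no zeros, so multiplication by it keeps the support.\<close>
  have supp: "compact (closure {z. h z * e z \<noteq> 0})"
    using h e_nz by (simp add: test_fun_def)
  have I: "integrable lborel (\<lambda>z. u z * e z)" if "test_fun u" for u
    unfolding e_def by (intro integrable_times_fchar test_fun_integrable that)
  have F: "fourier2 u (\<xi>, \<eta>) = (\<integral>z. u z * e z \<partial>lborel)" for u
    by (simp add: fourier2_eq e_def)
  note [continuous_intros] = test_fun_continuous[OF h] test_fun_partials[OF h, THEN test_fun_continuous]
  let ?u1 = "\<lambda>z. partial1 h z * e z - (2 * pi * \<i> * \<xi>) * (h z * e z)"
  have "integral\<^sup>L lborel ?u1 = 0"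
  proof (rule integral_partial_derivative_eq_0(1)[OF supp])
    fix x y
    have "((\<lambda>x. e (x, y)) has_vector_derivative - (2 * pi * \<i> * \<xi>) * e (x, y)) (at x)"
      using has_vector_derivative_fchar[of \<xi> "y * \<eta>" x] by (simp add: e_def mult.commute)
    from has_vector_derivative_mult[OF has_vector_derivative_partials(1)[OF h, of y x] this]
    show "((\<lambda>x. h (x, y) * e (x, y)) has_vector_derivative ?u1 (x, y)) (at x)"
      by (simp add: algebra_simps)
  next
    show "continuous_on UNIV ?u1" by (intro continuous_intros e_cont)
    show "integrable lborel ?u1"
      using I[OF h] I[OF test_fun_partials(1)[OF h]] by auto
  qed
  then show "fourier2 (partial1 h) (\<xi>, \<eta>) = (2 * pi * \<i> * \<xi>) * fourier2 h (\<xi>, \<eta>)"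
    using I[OF h] I[OF test_fun_partials(1)[OF h]] by (simp add: F)
  let ?u2 = "\<lambda>z. partial2 h z * e z - (2 * pi * \<i> * \<eta>) * (h z * e z)"
  have "integral\<^sup>L lborel ?u2 = 0"
  proof (rule integral_partial_derivative_eq_0(2)[OF supp])
    fix x y
    have "((\<lambda>y. e (x, y)) has_vector_derivative - (2 * pi * \<i> * \<eta>) * e (x, y)) (at y)"
      using has_vector_derivative_fchar[of \<eta> "x * \<xi>" y] by (simp add: e_def mult.commute add.commute)
    from has_vector_derivative_mult[OF has_vector_derivative_partials(2)[OF h, of x y] this]
    show "((\<lambda>y. h (x, y) * e (x, y)) has_vector_derivative ?u2 (x, y)) (at y)"
      by (simp add: algebra_simps)
  next
    show "continuous_on UNIV ?u2" by (intro continuous_intros e_cont)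
    show "integrable lborel ?u2"
      using I[OF h] I[OF test_fun_partials(2)[OF h]] by auto
  qed
  then show "fourier2 (partial2 h) (\<xi>, \<eta>) = (2 * pi * \<i> * \<eta>) * fourier2 h (\<xi>, \<eta>)"
    using I[OF h] I[OF test_fun_partials(2)[OF h]] by (simp add: F)
qed

lemma fourier2_partials_funpow:
  assumes h: "test_fun h"
  shows "fourier2 ((partial1 ^^ n) h) (\<xi>, \<eta>) = (2 * pi * \<i> * \<xi>) ^ n * fourier2 h (\<xi>, \<eta>)"
    and "fourier2 ((partial2 ^^ n) h) (\<xi>, \<eta>) = (2 * pi * \<i> * \<eta>) ^ n * fourier2 h (\<xi>, \<eta>)"
  by (induction n) (simp_all add: fourier2_partials test_fun_partials_funpow h)

lemma fourier2_differential_equation: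
  assumes h: "test_fun h" and eq: "\<And>z. (partial1 ^^ k) h z - \<tau> * (partial2 ^^ l) h z = f z"
  shows "fourier2 f (\<xi>, \<eta>) = ((2 * pi * \<i> * \<xi>) ^ k - \<tau> * (2 * pi * \<i> * \<eta>) ^ l) * fourier2 h (\<xi>, \<eta>)"
proof -
  have I: "integrable lborel (\<lambda>z. u z * fchar (fst z * \<xi> + snd z * \<eta>))" if "test_fun u" for u
    by (intro integrable_times_fchar test_fun_integrable that)
  have "fourier2 f (\<xi>, \<eta>) = (\<integral>z. (partial1 ^^ k) h z * fchar (fst z * \<xi> + snd z * \<eta>)
      - \<tau> * ((partial2 ^^ l) h z * fchar (fst z * \<xi> + snd z * \<eta>)) \<partial>lborel)"
    unfolding fourier2_eq eq[symmetric] by (simp add: algebra_simps)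
  also have "\<dots> = fourier2 ((partial1 ^^ k) h) (\<xi>, \<eta>) - \<tau> * fourier2 ((partial2 ^^ l) h) (\<xi>, \<eta>)"
    using I test_fun_partials_funpow[OF h] by (simp add: fourier2_eq)
  also have "\<dots> = ((2 * pi * \<i> * \<xi>) ^ k - \<tau> * (2 * pi * \<i> * \<eta>) ^ l) * fourier2 h (\<xi>, \<eta>)"
    unfolding fourier2_partials_funpow[OF h] by (simp add: algebra_simps)
  finally show ?thesis .
qed

section \<open>The bilinear estimate\<close>

text \<open>If \<open>f\<close> is not integrable, the Bochner integral is 0 by convention and the
  inequality is trivial.\<close>

lemma norm_integral_le_nn_integral:
  fixes f :: "'a \<Rightarrow> 'b::{banach, second_countable_topology}"
  shows "ennreal (norm (integral\<^sup>L M f)) \<le> (\<integral>\<^sup>+x. norm (f x) \<partial>M)"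
  by (cases "integrable M f") (auto intro: integral_norm_bound_ennreal simp: not_integrable_integral_eq)

section \<open>Tensor products and exchange of integrals\<close>

lemma integrable_tensor:
  fixes f :: "'a::euclidean_space \<Rightarrow> complex" and g :: "'b::euclidean_space \<Rightarrow> complex"
  assumes f: "integrable lborel f" and g: "integrable lborel g"
  shows "integrable (lborel \<Otimes>\<^sub>M lborel) (\<lambda>(x, y). f x * g y)"
proof (rule lborel_pair.Fubini_integrable)
  note [measurable] = borel_measurable_integrable[OF f] borel_measurable_integrable[OF g]
  show "(\<lambda>(x, y). f x * g y) \<in> borel_measurable (lborel \<Otimes>\<^sub>M lborel)"
    by measurable
qed (use f g in \<open>auto simp: norm_mult\<close>)

lemma integral_tensor:
  fixes f :: "'a::euclidean_space \<Rightarrow> complex" and g :: "'b::euclidean_space \<Rightarrow> complex"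
  assumes "integrable lborel f" and "integrable lborel g"
  shows "(\<integral>p. f (fst p) * g (snd p) \<partial>lborel) = integral\<^sup>L lborel f * integral\<^sup>L lborel g"
  using lborel_pair.integral_fst[OF integrable_tensor[OF assms]]
  by (simp add: lborel_prod case_prod_unfold)

text \<open>Fubini, with \<bar>H\<bar> \<bar>r\<bar> as integrable majorant. It allows the
  \<xi>-integral to be evaluated before the integrals that define the Fourier transforms.\<close>

lemma integral_swap_bounded_kernel:
  fixes H :: "'a::euclidean_space \<Rightarrow> complex" and r :: "real \<Rightarrow> complex" and E :: "'a \<times> real \<Rightarrow> complex"
  assumes H: "integrable lborel H" and r: "integrable lborel r"
    and E: "continuous_on UNIV E" "\<And>w. norm (E w) \<le> 1"
  shows "(\<integral>x. r x * (\<integral>p. H p * E (p, x) \<partial>lborel) \<partial>lborel) = (\<integral>p. H p * (\<integral>x. E (p, x) * r x \<partial>lborel) \<partial>lborel)"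
proof -
  note [measurable] = borel_measurable_integrable[OF H] borel_measurable_integrable[OF r]
  have [measurable]: "E \<in> borel_measurable (lborel \<Otimes>\<^sub>M lborel)"
    using borel_measurable_continuous_onI[OF E(1)] by (simp add: lborel_prod)
  have "integrable (lborel \<Otimes>\<^sub>M lborel) (\<lambda>(p, x). H p * E (p, x) * r x)"
  proof (rule Bochner_Integration.integrable_bound[OF integrable_tensor[OF H r]])
    show "AE w in lborel \<Otimes>\<^sub>M lborel. norm (case w of (p, x) \<Rightarrow> H p * E (p, x) * r x)
        \<le> norm (case w of (p, x) \<Rightarrow> H p * r x)"
      using E(2) by (intro AE_I2) (auto simp: norm_mult intro!: mult_right_mono mult_left_le)
  qed measurable
  from lborel_pair.Fubini_integral[OF this] show ?thesis
    by (simp add: ac_simps flip: integral_mult_right_zero)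
qed

text \<open>The substitution \<open>x \<mapsto> \<bar>y\<bar> powr (l/k) * x\<close> reduces to \<open>\<bar>y\<bar> = 1\<close>; the sign of \<open>y ^ l\<close> may turn
  \<open>(\<alpha>, \<beta>)\<close> into \<open>(-\<alpha>, -\<beta>)\<close>.\<close>
lemma scaled_kernel_bound:
  assumes k: "k > 0" and im: "Im \<alpha> \<noteq> 0" "Im \<beta> \<noteq> 0"
    and sgn: "sgn (Im \<alpha>) = sgn (Im \<beta>)" and ne: "\<alpha> \<noteq> \<beta>"
  obtains C :: real where "C \<ge> 0"
    "\<And>s y. y \<noteq> 0 \<Longrightarrow> norm (\<integral>x. fchar (s * x) * rat_kernel k (\<alpha> * of_real y ^ l) (\<beta> * of_real y ^ l) x \<partial>lborel)
      \<le> C * min (sqrt (\<bar>s\<bar> * \<bar>y\<bar> powr (l / k))) (1 / (\<bar>s\<bar> * \<bar>y\<bar> powr (l / k))) / \<bar>y\<bar> ^ l"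
proof -
  obtain C1 where C1: "C1 \<ge> 0"
    "\<And>s. norm (\<integral>x. fchar (s * x) * rat_kernel k \<alpha> \<beta> x \<partial>lborel) \<le> C1 * min (sqrt \<bar>s\<bar>) (1 / \<bar>s\<bar>)"
    using kernel_bound[OF assms] by metis
  obtain C2 where C2: "C2 \<ge> 0"
    "\<And>s. norm (\<integral>x. fchar (s * x) * rat_kernel k (- \<alpha>) (- \<beta>) x \<partial>lborel) \<le> C2 * min (sqrt \<bar>s\<bar>) (1 / \<bar>s\<bar>)"
    using kernel_bound[of k "- \<alpha>" "- \<beta>"] assms by (auto simp: sgn_minus)
  show thesis
  proof
    show "C1 + C2 \<ge> 0" using C1 C2 by simp
    fix s y :: real
    assume y: "y \<noteq> 0"
    \<comment> \<open>The positive k-th root of \<bar>y\<bar> ^ l; with the sign \<epsilon> below, y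
      ^ l = \<epsilon> * r ^ k.\<close>
    define r where "r = \<bar>y\<bar> powr (l / k)"
    have r: "r > 0" "r ^ k = \<bar>y\<bar> ^ l"
      using y k by (auto simp: r_def powr_powr simp flip: powr_realpow)
    define \<epsilon> :: real where "\<epsilon> = sgn y ^ l"
    have \<epsilon>: "\<epsilon> = 1 \<or> \<epsilon> = -1"
      using y by (auto simp: \<epsilon>_def sgn_if minus_one_power_iff)
    have "y ^ l = \<epsilon> * r ^ k"
      by (simp add: \<epsilon>_def r sgn_mult_abs flip: power_mult_distrib)
    then have yl: "complex_of_real y ^ l = of_real \<epsilon> * of_real r ^ k"
      by (metis of_real_mult of_real_power)
    \<comment> \<open>The numerator contributes r ^ (k - 1) and the denominator r ^ (2 k). The
      factor r from dx then leaves 1 / r ^ k = 1 / \<bar>y\<bar> ^ l.\<close>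
    have scale: "rat_kernel k (\<alpha> * of_real y ^ l) (\<beta> * of_real y ^ l) (r * x)
        = rat_kernel k (of_real \<epsilon> * \<alpha>) (of_real \<epsilon> * \<beta>) x / (of_real r ^ k * of_real r)" for x
    proof -
      have "of_real (r * x) ^ (k - 1) = complex_of_real r ^ k * of_real x ^ (k - 1) / of_real r"
        using r k by (simp add: power_mult_distrib power_diff)
      moreover have "(of_real (r * x)) ^ k - \<gamma> * of_real y ^ l = complex_of_real r ^ k * (of_real x ^ k - of_real \<epsilon> * \<gamma>)" for \<gamma>
        by (simp add: yl algebra_simps)
      ultimately show ?thesis
        using r unfolding rat_kernel_def by simp
    qed
    have "(\<integral>x. fchar (s * x) * rat_kernel k (\<alpha> * of_real y ^ l) (\<beta> * of_real y ^ l) x \<partial>lborel)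
      = r *\<^sub>R (\<integral>x. fchar (s * (r * x)) * rat_kernel k (\<alpha> * of_real y ^ l) (\<beta> * of_real y ^ l) (r * x) \<partial>lborel)"
      using r by (subst lborel_integral_real_affine[where c = r and t = 0]) auto
    also have "\<dots> = (\<integral>x. fchar ((s * r) * x) * rat_kernel k (of_real \<epsilon> * \<alpha>) (of_real \<epsilon> * \<beta>) x \<partial>lborel) / of_real r ^ k"
      using r by (simp add: scale mult.assoc scaleR_conv_of_real)
    finally have eq: "norm (\<integral>x. fchar (s * x) * rat_kernel k (\<alpha> * of_real y ^ l) (\<beta> * of_real y ^ l) x \<partial>lborel)
      = norm (\<integral>x. fchar ((s * r) * x) * rat_kernel k (of_real \<epsilon> * \<alpha>) (of_real \<epsilon> * \<beta>) x \<partial>lborel) / \<bar>y\<bar> ^ l"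
      using r by (simp add: norm_divide norm_power)
    let ?m = "min (sqrt \<bar>s * r\<bar>) (1 / \<bar>s * r\<bar>)"
    have m: "?m \<ge> 0" by simp
    have "norm (\<integral>x. fchar ((s * r) * x) * rat_kernel k (of_real \<epsilon> * \<alpha>) (of_real \<epsilon> * \<beta>) x \<partial>lborel) \<le> (C1 + C2) * ?m"
      using \<epsilon>
    proof
      assume "\<epsilon> = 1"
      then show ?thesis
        using C1(2)[of "s * r"] mult_nonneg_nonneg[OF C2(1) m] by (simp add: distrib_right)
    next
      assume "\<epsilon> = -1"
      then show ?thesis
        using C2(2)[of "s * r"] mult_nonneg_nonneg[OF C1(1) m] by (simp add: distrib_right)
    qed
    moreover have "\<bar>s * r\<bar> = \<bar>s\<bar> * \<bar>y\<bar> powr (l / k)"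
      by (simp add: r_def abs_mult)
    ultimately show "norm (\<integral>x. fchar (s * x) * rat_kernel k (\<alpha> * of_real y ^ l) (\<beta> * of_real y ^ l) x \<partial>lborel)
      \<le> (C1 + C2) * min (sqrt (\<bar>s\<bar> * \<bar>y\<bar> powr (l / k))) (1 / (\<bar>s\<bar> * \<bar>y\<bar> powr (l / k))) / \<bar>y\<bar> ^ l"
      unfolding eq by (intro divide_right_mono) auto
  qed
qed

text \<open>The product becomes one integral over pairs of points, whose phase depends only on
  coordinate differences. The \<xi>-phase stands apart, as it alone takes part in the inner
  integration.\<close>

lemma fourier2_times_cnj_fourier2:
  assumes f: "integrable lborel f" and g: "integrable lborel g"
  shows "fourier2 f (\<xi>, \<eta>) * cnj (fourier2 g (\<xi>, \<eta>)) =
    (\<integral>p. (f (fst p) * cnj (g (snd p)) * fchar ((snd (fst p) - snd (snd p)) * \<eta>))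
        * fchar ((fst (fst p) - fst (snd p)) * \<xi>) \<partial>lborel)"
proof -
  let ?e = "\<lambda>z::real \<times> real. fchar (fst z * \<xi> + snd z * \<eta>)"
  have "fourier2 f (\<xi>, \<eta>) * cnj (fourier2 g (\<xi>, \<eta>)) = (\<integral>z. f z * ?e z \<partial>lborel) * (\<integral>z. cnj (g z * ?e z) \<partial>lborel)"
    by (simp add: fourier2_eq del: complex_cnj_mult)
  also have "\<dots> = (\<integral>p. (f (fst p) * ?e (fst p)) * cnj (g (snd p) * ?e (snd p)) \<partial>lborel)"
    by (intro integral_tensor[symmetric] integrable_times_fchar f integrable_cnj g)
  also have "\<dots> = (\<integral>p. (f (fst p) * cnj (g (snd p)) * fchar ((snd (fst p) - snd (snd p)) * \<eta>))
        * fchar ((fst (fst p) - fst (snd p)) * \<xi>) \<partial>lborel)"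
    by (intro Bochner_Integration.integral_cong)
       (simp_all add: cnj_fchar fchar_add[symmetric] algebra_simps)
  finally show ?thesis .
qed

text \<open>After the exchange of integrals the \<eta>-phase has modulus 1 and disappears from the
  bound. What remains is the transform of \<open>r\<close> at the difference of the first
  coordinates.\<close>

lemma norm_slice_integral_le:
  assumes f: "integrable lborel f" and g: "integrable lborel g" and r: "integrable lborel r"
    and K: "\<And>s. norm (\<integral>x. fchar (s * x) * r x \<partial>lborel) \<le> K s"
  shows "ennreal (norm (\<integral>\<xi>. r \<xi> * (fourier2 f (\<xi>, \<eta>) * cnj (fourier2 g (\<xi>, \<eta>))) \<partial>lborel))
    \<le> (\<integral>\<^sup>+p. ennreal (norm (f (fst p)) * norm (g (snd p)) * K (fst (fst p) - fst (snd p))) \<partial>lborel)"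
proof -
  let ?H = "\<lambda>p. f (fst p) * cnj (g (snd p)) * fchar ((snd (fst p) - snd (snd p)) * \<eta>)"
  let ?E = "\<lambda>w::((real \<times> real) \<times> (real \<times> real)) \<times> real. fchar ((fst (fst (fst w)) - fst (snd (fst w))) * snd w)"
  have fg: "integrable lborel (\<lambda>p. f (fst p) * cnj (g (snd p)))"
    using integrable_tensor[OF f integrable_cnj[OF g]] by (simp add: lborel_prod case_prod_unfold)
  have H: "integrable lborel ?H"
  proof (rule Bochner_Integration.integrable_bound[OF fg])
    note [measurable] = borel_measurable_integrable[OF fg]
    have "(\<lambda>p::(real \<times> real) \<times> (real \<times> real). fchar ((snd (fst p) - snd (snd p)) * \<eta>)) \<in> borel_measurable borel"
      by (intro borel_measurable_continuous_onI continuous_on_compose2[OF continuous_fchar] continuous_intros) auto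
    then show "?H \<in> borel_measurable lborel" by measurable
  qed (auto simp: norm_mult)
  have E: "continuous_on UNIV ?E"
    by (intro continuous_on_compose2[OF continuous_fchar] continuous_intros) auto
  have "(\<integral>\<xi>. r \<xi> * (fourier2 f (\<xi>, \<eta>) * cnj (fourier2 g (\<xi>, \<eta>))) \<partial>lborel)
     = (\<integral>p. ?H p * (\<integral>x. fchar ((fst (fst p) - fst (snd p)) * x) * r x \<partial>lborel) \<partial>lborel)"
    unfolding fourier2_times_cnj_fourier2[OF f g]
    using integral_swap_bounded_kernel[OF H r E] by simp
  also have "ennreal (norm \<dots>) \<le> (\<integral>\<^sup>+p. norm (?H p * (\<integral>x. fchar ((fst (fst p) - fst (snd p)) * x) * r x \<partial>lborel)) \<partial>lborel)"
    by (rule norm_integral_le_nn_integral)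
  also have "\<dots> \<le> (\<integral>\<^sup>+p. ennreal (norm (f (fst p)) * norm (g (snd p)) * K (fst (fst p) - fst (snd p))) \<partial>lborel)"
    by (intro nn_integral_mono ennreal_leI) (auto simp: norm_mult intro!: mult_left_mono K)
  finally show ?thesis .
qed

text \<open>By Tonelli, integrate in y first: the result is at most \<open>B\<close> whatever the
  difference of the first coordinates, and the remaining integral is the product of the two
  norms.\<close>

lemma nn_integral_tensor_kernel_le:
  fixes K :: "real \<Rightarrow> real \<Rightarrow> real" and f g :: "real \<times> real \<Rightarrow> complex"
  assumes f: "integrable lborel f" and g: "integrable lborel g"
    and K [measurable]: "(\<lambda>(s, y). K s y) \<in> borel_measurable borel" and K0: "\<And>s y. K s y \<ge> 0"
    and KB: "\<And>s. (\<integral>\<^sup>+y. ennreal (K s y) \<partial>lborel) \<le> ennreal B" and B: "B \<ge> 0"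
  shows "(\<integral>\<^sup>+y. (\<integral>\<^sup>+p. ennreal (norm (f (fst p)) * norm (g (snd p)) * K (fst (fst p) - fst (snd p)) y) \<partial>lborel) \<partial>lborel)
    \<le> ennreal (B * L1norm f * L1norm g)"
proof -
  let ?fg = "\<lambda>p. norm (f (fst p)) * norm (g (snd p))"
  let ?s = "\<lambda>p::(real \<times> real) \<times> (real \<times> real). fst (fst p) - fst (snd p)"
  have fg: "integrable lborel (\<lambda>p. f (fst p) * g (snd p))"
    using integrable_tensor[OF f g] by (simp add: lborel_prod case_prod_unfold)
  have ifg: "integrable lborel ?fg"
    using integrable_norm[OF fg] by (simp add: norm_mult)
  have fg_meas: "?fg \<in> borel_measurable borel"
    using borel_measurable_integrable[OF ifg] by simp
  have [measurable]: "?s \<in> borel_measurable borel"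
    by (intro borel_measurable_continuous_onI continuous_intros)
  have [measurable]: "(\<lambda>w. K (fst w) (snd w)) \<in> borel_measurable (borel \<Otimes>\<^sub>M borel)"
    using K by (simp add: borel_prod case_prod_unfold)
  have Ks: "(\<lambda>w. K (?s (fst w)) (snd w)) \<in> borel_measurable (borel \<Otimes>\<^sub>M borel)"
    using measurable_compose[of "\<lambda>w. (?s (fst w), snd w)" "borel \<Otimes>\<^sub>M borel" "borel \<Otimes>\<^sub>M borel" "\<lambda>w. K (fst w) (snd w)" borel]
    by simp
  have Ks1 [measurable]: "K s \<in> borel_measurable borel" for s
    using measurable_compose[of "\<lambda>y. (s, y)" borel "borel \<Otimes>\<^sub>M borel" "\<lambda>w. K (fst w) (snd w)" borel]
    by simp
  have "(\<integral>\<^sup>+y. (\<integral>\<^sup>+p. ennreal (?fg p * K (?s p) y) \<partial>lborel) \<partial>lborel)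
      = (\<integral>\<^sup>+p. (\<integral>\<^sup>+y. ennreal (?fg p * K (?s p) y) \<partial>lborel) \<partial>lborel)"
  proof (rule lborel_pair.Fubini')
    have "(\<lambda>w. ?fg (fst w) * K (?s (fst w)) (snd w)) \<in> borel_measurable (borel \<Otimes>\<^sub>M borel)"
      by (rule borel_measurable_times[OF measurable_compose[OF measurable_fst fg_meas] Ks])
    then show "(\<lambda>(p, y). ennreal (?fg p * K (?s p) y)) \<in> borel_measurable (lborel \<Otimes>\<^sub>M lborel)"
      by (simp add: case_prod_unfold cong: measurable_cong_sets sets_pair_measure_cong)
  qed
  also have "\<dots> \<le> (\<integral>\<^sup>+p. ennreal (?fg p) * ennreal B \<partial>lborel)"
  proof (intro nn_integral_mono)
    fix p
    have "(\<integral>\<^sup>+y. ennreal (?fg p * K (?s p) y) \<partial>lborel) = ennreal (?fg p) * (\<integral>\<^sup>+y. ennreal (K (?s p) y) \<partial>lborel)"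
      by (subst nn_integral_cmult[symmetric]) (auto simp: ennreal_mult K0)
    also have "\<dots> \<le> ennreal (?fg p) * ennreal B"
      by (intro mult_left_mono KB) auto
    finally show "(\<integral>\<^sup>+y. ennreal (?fg p * K (?s p) y) \<partial>lborel) \<le> ennreal (?fg p) * ennreal B" .
  qed
  also have "\<dots> = (\<integral>\<^sup>+p. ennreal (?fg p) \<partial>lborel) * ennreal B"
    by (intro nn_integral_multc) (use fg_meas in simp)
  also have "(\<integral>\<^sup>+p. ennreal (?fg p) \<partial>lborel) = ennreal (\<integral>p. ?fg p \<partial>lborel)"
    using ifg by (intro nn_integral_eq_integral) auto
  \<comment> \<open>The norms are embedded in the complex numbers, where
    \<open>integral_tensor\<close> is stated.\<close>
  also have "(\<integral>p. ?fg p \<partial>lborel) = L1norm f * L1norm g"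
    using integral_tensor[of "\<lambda>z. of_real (norm (f z))" "\<lambda>z. of_real (norm (g z))"] f g
    unfolding L1norm_def by (simp flip: of_real_mult)
  also have "ennreal (L1norm f * L1norm g) * ennreal B = ennreal (B * L1norm f * L1norm g)"
    using B by (simp add: L1norm_def ac_simps flip: ennreal_mult)
  finally show ?thesis .
qed

text \<open>Pulling out (2 pi i) ^ k leaves the real power \<xi> ^ k and exposes the parameter of
  the theorem. An integer power is used since l - k may be negative.\<close>

lemma symbol_factorization:
  fixes \<tau> :: complex and \<xi> \<eta> :: real
  shows "(2 * pi * \<i> * \<xi>) ^ k - \<tau> * (2 * pi * \<i> * \<eta>) ^ l
    = (2 * pi * \<i>) ^ k * (of_real \<xi> ^ k - (2 * pi * \<i>) powi (int l - int k) * \<tau> * of_real \<eta> ^ l)"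
proof -
  have "(2 * pi * \<i>) ^ l = (2 * pi * \<i>) ^ k * (2 * pi * \<i>) powi (int l - int k)"
    by (simp add: power_int_diff)
  then show ?thesis
    by (simp add: algebra_simps)
qed

text \<open>Conjugation sends 2 pi i to -2 pi i. Hence the theorem's second parameter is the
  conjugate of the one in the symbol for \<sigma>, as is natural for a conjugated second
  transform.\<close>

lemma cnj_2pi_i_powi: "cnj ((2 * pi * \<i>) powi n * \<sigma>) = (- 1) powi n * (2 * pi * \<i>) powi n * cnj \<sigma>"
proof -
  have "cnj ((2 * pi * \<i>) powi n) = (- 1 * (2 * pi * \<i>)) powi n"
    by (cases "n \<ge> 0") (simp_all add: power_int_def)
  then show ?thesis
    by (simp only: complex_cnj_mult power_int_mult_distrib)
qed

lemma W_inner_bound: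
  fixes k l :: nat and \<sigma> \<tau> \<alpha> \<beta> :: complex
  defines "\<alpha> \<equiv> (2 * pi * \<i>) powi (int l - int k) * \<tau>"
    and "\<beta> \<equiv> cnj ((2 * pi * \<i>) powi (int l - int k) * \<sigma>)"
  assumes k: "k > 0" "odd k" and l: "l > 0" and im: "Im \<alpha> \<noteq> 0" "Im \<beta> \<noteq> 0"
    and sgn: "sgn (Im \<alpha>) = sgn (Im \<beta>)" and ne: "\<alpha> \<noteq> \<beta>"
  shows "\<exists>C::real. \<forall>f g f1 g1.
           test_fun f \<and> test_fun g \<and> test_fun f1 \<and> test_fun g1 \<and>
           (\<forall>z. (partial1 ^^ k) f1 z - \<tau> * (partial2 ^^ l) f1 z = f z) \<and>
           (\<forall>z. (partial1 ^^ k) g1 z - \<sigma> * (partial2 ^^ l) g1 z = g z)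
           \<longrightarrow> norm (W_inner k l f1 g1) \<le> C * L1norm f * L1norm g"
proof -
  obtain C where C0: "C \<ge> 0"
    and C1: "\<And>s y. y \<noteq> 0 \<Longrightarrow> norm (\<integral>x. fchar (s * x) * rat_kernel k (\<alpha> * of_real y ^ l) (\<beta> * of_real y ^ l) x \<partial>lborel)
      \<le> C * min (sqrt (\<bar>s\<bar> * \<bar>y\<bar> powr (l / k))) (1 / (\<bar>s\<bar> * \<bar>y\<bar> powr (l / k))) / \<bar>y\<bar> ^ l"
    by (rule scaled_kernel_bound[OF k(1) im sgn ne, where l = l]) (rule that; assumption)
  define N :: "real \<Rightarrow> real \<Rightarrow> real" where
    "N s y = min (sqrt (\<bar>s\<bar> * \<bar>y\<bar> powr (l / k))) (1 / (\<bar>s\<bar> * \<bar>y\<bar> powr (l / k)))" for s y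
  note C = C0 C1[folded N_def]
  obtain B where B: "B \<ge> 0" and B': "\<And>s. s \<ge> 0 \<Longrightarrow>
      (\<integral>\<^sup>+y. ennreal (min (sqrt (s * \<bar>y\<bar> powr (l / k))) (1 / (s * \<bar>y\<bar> powr (l / k))) / \<bar>y\<bar>) \<partial>lborel) \<le> ennreal B"
  proof -
    have "real l / real k > 0" using k l by simp
    then show ?thesis
      by (rule nn_integral_min_sqrt_inverse_bounded) (rule that; assumption)
  qed
  \<comment> \<open>The weight \<bar>y\<bar> ^ (l - 1) turns the factor 1 / \<bar>y\<bar> ^ l of the
    scaled kernel into 1 / \<bar>y\<bar>, the density of the scale-invariant measure.\<close>
  define K where "K s y = C * (N s y / \<bar>y\<bar>)" for s y
  have N0: "N s y \<ge> 0" for s y by (simp add: N_def)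
  have K0: "K s y \<ge> 0" for s y using C N0 by (simp add: K_def)
  have KB: "(\<integral>\<^sup>+y. ennreal (K s y) \<partial>lborel) \<le> ennreal (C * B)" for s
  proof -
    have "(\<integral>\<^sup>+y. ennreal (K s y) \<partial>lborel) = ennreal C * (\<integral>\<^sup>+y. ennreal (N s y / \<bar>y\<bar>) \<partial>lborel)"
      unfolding K_def ennreal_mult'[OF C0]
      by (intro nn_integral_cmult) (unfold N_def, measurable)
    also have "\<dots> \<le> ennreal C * ennreal B"
      using B'[of "\<bar>s\<bar>"] by (intro mult_left_mono) (auto simp: N_def)
    finally show ?thesis
      using C B by (simp add: ennreal_mult)
  qed
  have Kmeas: "(\<lambda>(s, y). K s y) \<in> borel_measurable borel"
    unfolding K_def N_def borel_prod[symmetric] by measurable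
  show ?thesis
  \<comment> \<open>\<open>C\<close> comes from the scaled kernel and \<open>B\<close> from the
    scale-invariant integral; both are fixed before the functions are.\<close>
  proof (intro exI[of _ "C * B"] allI impI, elim conjE)
    fix f g f1 g1
    assume tf: "test_fun f" "test_fun g" "test_fun f1" "test_fun g1"
      and eqf: "\<forall>z. (partial1 ^^ k) f1 z - \<tau> * (partial2 ^^ l) f1 z = f z"
      and eqg: "\<forall>z. (partial1 ^^ k) g1 z - \<sigma> * (partial2 ^^ l) g1 z = g z"
    define G where "G \<xi> \<eta> = fourier2 f1 (\<xi>, \<eta>) * cnj (fourier2 g1 (\<xi>, \<eta>))
                  * complex_of_real (\<bar>\<xi>\<bar> ^ (k - 1) * \<bar>\<eta>\<bar> ^ (l - 1))" for \<xi> \<eta>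
    have W: "W_inner k l f1 g1 = integral\<^sup>L lborel (\<lambda>(\<xi>, \<eta>). G \<xi> \<eta>)"
      by (simp add: W_inner_def G_def)
    have L: "L1norm f \<ge> 0" "L1norm g \<ge> 0"
      by (auto simp: L1norm_def)
    let ?c = "(2 * pi) ^ (2 * k)"
    have c: "?c \<ge> 1"
      using pi_gt3 by (intro one_le_power) simp
    have slice: "ennreal (norm (\<integral>\<xi>. G \<xi> \<eta> \<partial>lborel))
       \<le> (\<integral>\<^sup>+p. ennreal (norm (f (fst p)) * norm (g (snd p)) * K (fst (fst p) - fst (snd p)) \<eta>) \<partial>lborel)"
      if \<eta>: "\<eta> \<noteq> 0" for \<eta>
    proof -
      let ?r = "\<lambda>\<xi>. of_real (\<bar>\<eta>\<bar> ^ (l - 1) / ?c) * rat_kernel k (\<alpha> * of_real \<eta> ^ l) (\<beta> * of_real \<eta> ^ l) \<xi>"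
      have imr: "Im (\<gamma> * of_real \<eta> ^ l) \<noteq> 0" if "Im \<gamma> \<noteq> 0" for \<gamma>
        using that \<eta> by (simp flip: of_real_power)
      have "G \<xi> \<eta> = ?r \<xi> * (fourier2 f (\<xi>, \<eta>) * cnj (fourier2 g (\<xi>, \<eta>)))" for \<xi>
      proof -
        let ?A = "complex_of_real \<xi> ^ k - \<alpha> * of_real \<eta> ^ l" and ?B = "complex_of_real \<xi> ^ k - \<beta> * of_real \<eta> ^ l"
        have nz: "?A \<noteq> 0" "?B \<noteq> 0"
          by (intro power_factor_nonzero imr im)+
        have ff: "fourier2 f (\<xi>, \<eta>) = (2 * pi * \<i>) ^ k * ?A * fourier2 f1 (\<xi>, \<eta>)"
          using fourier2_differential_equation[OF tf(3) eqf[rule_format], of \<xi> \<eta>]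
          unfolding symbol_factorization \<alpha>_def by simp
        have "fourier2 g (\<xi>, \<eta>) = (2 * pi * \<i>) ^ k * (of_real \<xi> ^ k - cnj \<beta> * of_real \<eta> ^ l) * fourier2 g1 (\<xi>, \<eta>)"
          using fourier2_differential_equation[OF tf(4) eqg[rule_format], of \<xi> \<eta>]
          unfolding symbol_factorization \<beta>_def by simp
        \<comment> \<open>As \<xi> and \<eta> are real, conjugation affects only the parameter and
          the constant factor, and \<open>cnj \<beta>\<close> becomes \<beta>.\<close>
        then have gg: "cnj (fourier2 g (\<xi>, \<eta>)) = cnj ((2 * pi * \<i>) ^ k) * ?B * cnj (fourier2 g1 (\<xi>, \<eta>))"
          by simp
        have "(2 * pi * \<i>) ^ k * cnj ((2 * pi * \<i>) ^ k) = complex_of_real ((norm ((2 * pi * \<i>) ^ k))\<^sup>2)"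
          by (rule complex_norm_square[symmetric])
        also have "(norm ((2 * pi * \<i>) ^ k))\<^sup>2 = ((2 * pi) ^ k)\<^sup>2"
          by (simp add: norm_mult norm_power)
        also have "\<dots> = ?c"
          by (simp only: power_mult[symmetric] mult.commute)
        finally have const: "(2 * pi * \<i>) ^ k * cnj ((2 * pi * \<i>) ^ k) = complex_of_real ?c" .
        have "fourier2 f (\<xi>, \<eta>) * cnj (fourier2 g (\<xi>, \<eta>))
            = complex_of_real ?c * (?A * ?B) * (fourier2 f1 (\<xi>, \<eta>) * cnj (fourier2 g1 (\<xi>, \<eta>)))"
          unfolding ff gg const[symmetric] by (simp only: mult_ac)
        moreover have cancel: "a / b * (x / d) * (b * d * X) = X * (x * a)" if "b \<noteq> 0" "d \<noteq> 0" for a b d x X :: complex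
          using that by simp
        \<comment> \<open>Oddness of \<open>k\<close> enters here: k - 1 is even, so the absolute
          value disappears and the weight matches the numerator of
          \<open>rat_kernel\<close>.\<close>
        moreover have "complex_of_real (\<bar>\<xi>\<bar> ^ (k - 1)) = of_real \<xi> ^ (k - 1)"
          using k by (simp add: power_even_abs)
        ultimately show ?thesis
          using nz c cancel[of "complex_of_real ?c" "?A * ?B"] unfolding G_def rat_kernel_def
          by (simp only: of_real_mult of_real_divide of_real_eq_0_iff mult_eq_0_iff) simp
      qed
      then have "ennreal (norm (\<integral>\<xi>. G \<xi> \<eta> \<partial>lborel))
        = ennreal (norm (\<integral>\<xi>. ?r \<xi> * (fourier2 f (\<xi>, \<eta>) * cnj (fourier2 g (\<xi>, \<eta>))) \<partial>lborel))"
        by simp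
      also have "\<dots> \<le> (\<integral>\<^sup>+p. ennreal (norm (f (fst p)) * norm (g (snd p)) * K (fst (fst p) - fst (snd p)) \<eta>) \<partial>lborel)"
      proof (rule norm_slice_integral_le)
        show "integrable lborel ?r"
          by (intro integrable_mult_right integrable_rat_kernel k imr im)
        fix s
        have "norm (\<integral>x. fchar (s * x) * ?r x \<partial>lborel)
          = \<bar>\<eta>\<bar> ^ (l - 1) / ?c * norm (\<integral>x. fchar (s * x) * rat_kernel k (\<alpha> * of_real \<eta> ^ l) (\<beta> * of_real \<eta> ^ l) x \<partial>lborel)"
          by (subst mult.left_commute, subst integral_mult_right_zero) (simp add: norm_mult norm_divide norm_power)
        also have "\<dots> \<le> \<bar>\<eta>\<bar> ^ (l - 1) / 1 * (C * N s \<eta> / \<bar>\<eta>\<bar> ^ l)"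
          using c by (intro mult_mono divide_left_mono C(2) \<eta>) auto
        also have "\<dots> = K s \<eta>"
          using \<eta> l by (cases l) (auto simp: K_def)
        finally show "norm (\<integral>x. fchar (s * x) * ?r x \<partial>lborel) \<le> K s \<eta>" .
      qed (use tf test_fun_integrable in auto)
      finally show ?thesis .
    qed
    show "norm (W_inner k l f1 g1) \<le> (C * B) * L1norm f * L1norm g"
    proof (cases "integrable lborel (\<lambda>(\<xi>, \<eta>). G \<xi> \<eta>)")
      case False
      \<comment> \<open>The Bochner integral of a non-integrable function is 0, so integrability of \<open>G\<close> need not be shown.\<close>
      then show ?thesis
        using B C L by (simp add: W not_integrable_integral_eq)
    next
      case True
      then have int: "integrable (lborel \<Otimes>\<^sub>M lborel) (\<lambda>(\<xi>, \<eta>). G \<xi> \<eta>)"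
        by (simp add: lborel_prod)
      have "ennreal (norm (W_inner k l f1 g1)) = ennreal (norm (\<integral>\<eta>. (\<integral>\<xi>. G \<xi> \<eta> \<partial>lborel) \<partial>lborel))"
        using lborel_pair.integral_snd[OF int] by (simp add: W lborel_prod)
      also have "\<dots> \<le> (\<integral>\<^sup>+\<eta>. ennreal (norm (\<integral>\<xi>. G \<xi> \<eta> \<partial>lborel)) \<partial>lborel)"
        by (rule norm_integral_le_nn_integral)
      \<comment> \<open>The slice estimate excludes \<eta> = 0, a null set.\<close>
      also have "\<dots> \<le> (\<integral>\<^sup>+\<eta>. (\<integral>\<^sup>+p. ennreal (norm (f (fst p)) * norm (g (snd p)) * K (fst (fst p) - fst (snd p)) \<eta>) \<partial>lborel) \<partial>lborel)"
        using AE_lborel_singleton[of "0::real"]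
        by (intro nn_integral_mono_AE) (auto elim!: eventually_mono intro: slice)
      also have "\<dots> \<le> ennreal (C * B * L1norm f * L1norm g)"
        using B C tf(1,2) by (intro nn_integral_tensor_kernel_le test_fun_integrable Kmeas K0 KB) auto
      finally show ?thesis
        using B C L by (subst (asm) ennreal_le_iff) auto
    qed
  qed
qed

theorem theorem6:
  fixes k l :: nat and \<sigma> \<tau> :: complex
  assumes "k > 0" and "l > 0" and "odd k"
    and "\<sigma> \<noteq> 0" and "\<tau> \<noteq> 0"
    and "(2 * pi * \<i>) powi (int l - int k) * \<tau>
           \<noteq> (- 1) powi (int l - int k) * (2 * pi * \<i>) powi (int l - int k) * cnj \<sigma>"
    and "Im ((2 * pi * \<i>) powi (int l - int k) * \<tau>) \<noteq> 0"
    and "Im ((- 1) powi (int l - int k) * (2 * pi * \<i>) powi (int l - int k) * cnj \<sigma>) \<noteq> 0"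
    and "sgn (Im ((2 * pi * \<i>) powi (int l - int k) * \<tau>))
           = sgn (Im ((- 1) powi (int l - int k) * (2 * pi * \<i>) powi (int l - int k) * cnj \<sigma>))"
  shows "\<exists>C::real. \<forall>f g f1 g1.
           test_fun f \<and> test_fun g \<and> test_fun f1 \<and> test_fun g1 \<and>
           (\<forall>z. (partial1 ^^ k) f1 z - \<tau> * (partial2 ^^ l) f1 z = f z) \<and>
           (\<forall>z. (partial1 ^^ k) g1 z - \<sigma> * (partial2 ^^ l) g1 z = g z)
           \<longrightarrow> norm (W_inner k l f1 g1) \<le> C * L1norm f * L1norm g"
  using assms(1-3,6-9) unfolding cnj_2pi_i_powi[symmetric] by (intro W_inner_bound)

end
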